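(* Let $O=(\rho,\gamma)$ be an object with $\rho,\gamma$ of full rank and let $Q=(\sigma,\sigma)$ be a qubit with energy gap $E>0$ in its equilibrium state at the reference inverse temperature $\beta$, i.e. $\sigma=\frac{1}{1+e^{-\beta E}}\,\mathrm{diag}(1,e^{-\beta E})$. Then $O$ can be used for cooling $Q$ if and only if the time average of $\rho$ differs from the equilibrium state, i.e. $$\overline{\rho}:=\sum_j P_j\rho P_j\neq\gamma,$$ where $P_j$ are the spectral projections of $\gamma$.
   Context: Fix a reference inverse temperature $\beta\in\mathbb{R}$, $\beta\ne0$. An object is a pair $(\rho,\gamma)$ of density matrices on a finite-dimensional complex Hilbert space, where $\gamma$ (the equilibrium state) has full rank; the Hamiltonian $H$ is determined up to an additive constant by $\gamma=e^{-\beta H}/\mathrm{tr}(e^{-\beta H})$. The time average is $\overline\rho=\lim_{t\to\infty}\frac1t\int_0^t e^{-iHs}\rho e^{iHs}\,ds=\sum_jP_j\rho P_j$. Equilibrium objects are those of the form $(\hat\gamma,\hat\gamma)$ with $\hat\gamma$ of full rank. The composition is $(\rho,\gamma)\times(\tilde\rho,\tilde\gamma)=(\rho\otimes\tilde\rho,\gamma\otimes\tilde\gamma)$. An allowed transformation on $(\rho,\gamma)$ is $\rho\mapsto u\rho u^*$ with $u$ a unitary commuting with $\gamma$. $O$ can be used for cooling $Q$ if there is a (finite-dimensional) equilibrium object $O_e$ and an allowed transformation on $O\times O_e\times Q$ that strictly decreases the occupation probability of the upper level of $Q$ (second basis vector), computed from the reduced state on $Q$. *)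

theory Defs
  imports "Jordan_Normal_Form.Schur_Decomposition" "Jordan_Normal_Form.DL_Rank"
begin

(* A finite-dimensional complex Hilbert space is taken to be C^n with its standard inner product
   (\<bullet>c in Jordan_Normal_Form); operators on it are n x n complex matrices. *)

definition trace_mat :: "complex mat \<Rightarrow> complex" where
  "trace_mat A = (\<Sum>i<dim_row A. A $$ (i, i))"

definition hermitian_mat :: "complex mat \<Rightarrow> bool" where
  "hermitian_mat A \<longleftrightarrow> square_mat A \<and> mat_adjoint A = A"

definition psd_mat :: "complex mat \<Rightarrow> bool" where
  "psd_mat A \<longleftrightarrow> hermitian_mat A \<and>
     (\<forall>v \<in> carrier_vec (dim_row A). 0 \<le> Re ((A *\<^sub>v v) \<bullet>c v))"

definition density_mat :: "complex mat \<Rightarrow> bool" where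
  "density_mat A \<longleftrightarrow> psd_mat A \<and> trace_mat A = 1"

definition full_rank :: "complex mat \<Rightarrow> bool" where
  "full_rank A \<longleftrightarrow> square_mat A \<and> vec_space.rank (dim_row A) A = dim_row A"

definition unitary_mat :: "complex mat \<Rightarrow> bool" where
  "unitary_mat U \<longleftrightarrow> square_mat U \<and>
     mat_adjoint U * U = 1\<^sub>m (dim_row U) \<and> U * mat_adjoint U = 1\<^sub>m (dim_row U)"

(* Row and column indices of the product are ordered lexicographically: the basis vector
   e_i \<otimes> e_k of C^m \<otimes> C^n has index i * n + k. *)
definition kronecker :: "complex mat \<Rightarrow> complex mat \<Rightarrow> complex mat" where
  "kronecker A B = mat (dim_row A * dim_row B) (dim_col A * dim_col B)
     (\<lambda>(i, j). A $$ (i div dim_row B, j div dim_col B) * B $$ (i mod dim_row B, j mod dim_col B))"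

(* Reduced state on the last factor C^d of C^m \<otimes> C^d, i.e. the partial trace over C^m. *)
definition reduced_last :: "nat \<Rightarrow> complex mat \<Rightarrow> complex mat" where
  "reduced_last d A = mat d d (\<lambda>(i, j). \<Sum>k < dim_row A div d. A $$ (k * d + i, k * d + j))"

definition eigenspace :: "complex mat \<Rightarrow> complex \<Rightarrow> complex vec set" where
  "eigenspace A l = {v \<in> carrier_vec (dim_row A). A *\<^sub>v v = l \<cdot>\<^sub>v v}"

definition is_orth_proj :: "nat \<Rightarrow> complex mat \<Rightarrow> complex vec set \<Rightarrow> bool" where
  "is_orth_proj n P W \<longleftrightarrow> P \<in> carrier_mat n n \<and> P * P = P \<and> mat_adjoint P = P \<and>
     (\<lambda>v. P *\<^sub>v v) ` carrier_vec n = W"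

definition spectral_proj :: "complex mat \<Rightarrow> complex \<Rightarrow> complex mat" where
  "spectral_proj A l = (THE P. is_orth_proj (dim_row A) P (eigenspace A l))"

(* Entrywise form of the matrix sum over the distinct eigenvalues l of G of P_l * R * P_l. *)
definition time_average :: "complex mat \<Rightarrow> complex mat \<Rightarrow> complex mat" where
  "time_average G R = mat (dim_row G) (dim_row G)
     (\<lambda>ij. \<Sum>l \<in> {l. eigenvalue G l}. (spectral_proj G l * R * spectral_proj G l) $$ ij)"

(* A pair (state, equilibrium state); the Hamiltonian enters only through the latter. *)
type_synonym obj = "complex mat \<times> complex mat"

definition is_object :: "obj \<Rightarrow> bool" where
  "is_object X \<longleftrightarrow> density_mat (fst X) \<and> density_mat (snd X) \<and>
     dim_row (fst X) = dim_row (snd X) \<and> full_rank (snd X)"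

definition equilibrium_object :: "obj \<Rightarrow> bool" where
  "equilibrium_object X \<longleftrightarrow> is_object X \<and> fst X = snd X"

definition compose_obj :: "obj \<Rightarrow> obj \<Rightarrow> obj" (infixl "\<times>\<^sub>o" 70) where
  "X \<times>\<^sub>o Y = (kronecker (fst X) (fst Y), kronecker (snd X) (snd Y))"

definition allowed_unitary :: "obj \<Rightarrow> complex mat \<Rightarrow> bool" where
  "allowed_unitary X u \<longleftrightarrow> unitary_mat u \<and> dim_row u = dim_row (snd X) \<and> u * snd X = snd X * u"

definition transform_state :: "complex mat \<Rightarrow> complex mat \<Rightarrow> complex mat" where
  "transform_state u R = u * R * mat_adjoint u"

(* The upper level of a qubit is its second basis vector, which has index 1. *)
definition upper_occupation :: "complex mat \<Rightarrow> real" where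
  "upper_occupation R = Re (R $$ (1, 1))"

definition usable_for_cooling :: "obj \<Rightarrow> obj \<Rightarrow> bool" where
  "usable_for_cooling X Q \<longleftrightarrow> (\<exists>Oe u. equilibrium_object Oe \<and> allowed_unitary (X \<times>\<^sub>o Oe \<times>\<^sub>o Q) u \<and>
     upper_occupation (reduced_last 2 (transform_state u (fst (X \<times>\<^sub>o Oe \<times>\<^sub>o Q))))
       < upper_occupation (reduced_last 2 (fst (X \<times>\<^sub>o Oe \<times>\<^sub>o Q))))"

definition qubit_gibbs :: "real \<Rightarrow> real \<Rightarrow> complex mat" where
  "qubit_gibbs \<beta> E = complex_of_real (1 / (1 + exp (- \<beta> * E))) \<cdot>\<^sub>m
     mat_diag 2 (\<lambda>i. if i = 0 then 1 else complex_of_real (exp (- \<beta> * E)))"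

end

(* In an eigenbasis of gamma the time average of rho is rho with all entries between different
   eigenvalues deleted, so it equals gamma iff rho and gamma agree on every eigenspace of gamma.

   If they agree, let G = gamma (x) C be the equilibrium state of the composite and R = rho (x) C
   its state. The upper occupation after u is tr (R X), where X commutes with G, and
   tr (R X) = tr (rho Y) for the partial trace Y of (1 (x) C) X, which commutes with gamma. Hence
   rho can be replaced by gamma, and the occupation of the invariant state G does not change.

   If they differ, two unit eigenvectors v, w of gamma with eigenvalues l, m satisfy
   <v, rho v> / l > <w, rho w> / m. An ancillary qubit with the appropriate gap makes
   v (x) e_0 (x) e_1 and w (x) e_1 (x) e_0 equally energetic, and exchanging them cools. *)

theory Submission
  imports Defs
begin

text \<open>The ratios <v, rho v> / l decide because the exchange removes from the upper level the
  weight d_1 <v, rho v> and brings in d_2 <w, rho w>, where d is the diagonal of ancilla \<otimes>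
  target. Equal energy means l d_1 = m d_2, so after division by this common value the net change is
  a difference of ratios. The factors e_0 \<otimes> e_1 and e_1 \<otimes> e_0 are orthogonal
  whatever v and w are. So v and w may be non-orthogonal vectors of one eigenspace, which is how
  coherence between levels of equal energy becomes usable. No pair v, w is exhibited. If cooling
  fails, the ratios of any two unit eigenvectors bound each other in both orders, so the ratio is
  constant, and this rigidity forces the time average to be gamma. One kind of unitary serves
  throughout: the reflection along the difference of two vectors. It carries out the exchange, and
  it is also the step that splits off an eigenvector when a Hermitian matrix is
  diagonalized.\<close>

section \<open>Adjoint, inner product and trace in coordinates\<close>

lemma mat_adjoint_carrier [simp]:
  "A \<in> carrier_mat m n \<Longrightarrow> mat_adjoint A \<in> carrier_mat n m"
  unfolding mat_adjoint_def by (auto simp: mat_of_rows_def)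

lemma mat_adjoint_dim [simp]:
  "dim_row (mat_adjoint A) = dim_col A" "dim_col (mat_adjoint A) = dim_row A"
  unfolding mat_adjoint_def by (auto simp: mat_of_rows_def)

lemma mat_adjoint_index [simp]:
  fixes A :: "complex mat"
  assumes "i < dim_col A" "j < dim_row A"
  shows "mat_adjoint A $$ (i, j) = cnj (A $$ (j, i))"
  using assms unfolding mat_adjoint_def by (simp add: mat_of_rows_def)

lemma index_mult_mat_sum:
  assumes "A \<in> carrier_mat m n" "B \<in> carrier_mat n k" "i < m" "j < k"
  shows "(A * B) $$ (i, j) = (\<Sum>l<n. A $$ (i, l) * B $$ (l, j))"
  using assms by (auto simp: scalar_prod_def lessThan_atLeast0)

lemma index_mult_mat_vec_sum:
  assumes "A \<in> carrier_mat m n" "v \<in> carrier_vec n" "i < m"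
  shows "(A *\<^sub>v v) $ i = (\<Sum>l<n. A $$ (i, l) * v $ l)"
  using assms by (auto simp: scalar_prod_def lessThan_atLeast0)

lemma cscalar_prod_sum:
  fixes v w :: "complex vec"
  assumes "w \<in> carrier_vec n"
  shows "v \<bullet>c w = (\<Sum>i<n. v $ i * cnj (w $ i))"
  using assms by (auto simp: scalar_prod_def lessThan_atLeast0)

lemma mat_adjoint_mult:
  fixes A B :: "complex mat"
  assumes "A \<in> carrier_mat m n" "B \<in> carrier_mat n k"
  shows "mat_adjoint (A * B) = mat_adjoint B * mat_adjoint A"
  using assms by (intro eq_matI)
    (auto simp: index_mult_mat_sum[of A m n B k] index_mult_mat_sum[of _ k n _ m] mult.commute
      simp del: index_mult_mat(1) intro!: sum.cong)

lemma mat_adjoint_adjoint [simp]: "mat_adjoint (mat_adjoint (A :: complex mat)) = A"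
  by (intro eq_matI) auto

lemma mat_adjoint_one [simp]: "mat_adjoint (1\<^sub>m n :: complex mat) = 1\<^sub>m n"
  by (intro eq_matI) auto

lemma cscalar_prod_mat_adjoint:
  fixes A :: "complex mat"
  assumes "A \<in> carrier_mat m n" "v \<in> carrier_vec n" "w \<in> carrier_vec m"
  shows "(A *\<^sub>v v) \<bullet>c w = v \<bullet>c (mat_adjoint A *\<^sub>v w)"
proof -
  have "(A *\<^sub>v v) \<bullet>c w = (\<Sum>i<m. \<Sum>l<n. A $$ (i, l) * v $ l * cnj (w $ i))"
    using assms by (simp add: cscalar_prod_sum[of w m] index_mult_mat_vec_sum[of A m n] sum_distrib_right
      del: index_mult_mat_vec)
  also have "\<dots> = (\<Sum>l<n. \<Sum>i<m. A $$ (i, l) * v $ l * cnj (w $ i))"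
    by (rule sum.swap)
  also have "\<dots> = v \<bullet>c (mat_adjoint A *\<^sub>v w)"
    using assms by (subst cscalar_prod_sum[of _ n])
      (auto simp: index_mult_mat_vec_sum[of _ n m] sum_distrib_left mult_ac
      simp del: index_mult_mat_vec intro!: sum.cong mult_mat_vec_carrier[OF mat_adjoint_carrier])
  finally show ?thesis .
qed

lemma trace_mat_mult_comm:
  assumes "A \<in> carrier_mat m n" "B \<in> carrier_mat n m"
  shows "trace_mat (A * B) = trace_mat (B * A)"
proof -
  have "trace_mat (A * B) = (\<Sum>i<m. \<Sum>l<n. A $$ (i, l) * B $$ (l, i))"
    using assms by (simp add: trace_mat_def index_mult_mat_sum[of A m n B m] del: index_mult_mat(1))
  also have "\<dots> = (\<Sum>l<n. \<Sum>i<m. A $$ (i, l) * B $$ (l, i))"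
    by (rule sum.swap)
  also have "\<dots> = trace_mat (B * A)"
    using assms by (simp add: trace_mat_def index_mult_mat_sum[of B n m A n] mult.commute del: index_mult_mat(1))
  finally show ?thesis .
qed

subsection \<open>Reflections\<close>

text \<open>For \<open>z = 0\<close> the quotient is 0 by convention and the matrix is the identity.
  This keeps the reflection along \<open>v - w\<close> meaningful when the two vectors to be swapped
  coincide.\<close>

definition householder :: "complex vec \<Rightarrow> complex mat" where
  "householder z = mat (dim_vec z) (dim_vec z)
     (\<lambda>(i, j). (if i = j then 1 else 0) - 2 / (z \<bullet>c z) * (z $ i * cnj (z $ j)))"

lemma householder_carrier [simp]:
  "z \<in> carrier_vec n \<Longrightarrow> householder z \<in> carrier_mat n n"
  by (simp add: householder_def)

lemma cscalar_prod_self_real: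
  fixes z :: "complex vec"
  shows "cnj (z \<bullet>c z) = z \<bullet>c z"
  by (simp add: cscalar_prod_sum[of z "dim_vec z"] mult.commute)

lemma householder_adjoint: "mat_adjoint (householder z) = householder z"
  by (intro eq_matI) (auto simp: householder_def mult.commute cscalar_prod_self_real)

lemma householder_mult_vec:
  assumes "z \<in> carrier_vec n" "x \<in> carrier_vec n"
  shows "householder z *\<^sub>v x = x - (2 / (z \<bullet>c z) * (x \<bullet>c z)) \<cdot>\<^sub>v z"
proof (rule eq_vecI)
  fix i assume "i < dim_vec (x - (2 / (z \<bullet>c z) * (x \<bullet>c z)) \<cdot>\<^sub>v z)"
  with assms have i: "i < n" by simp
  define c where "c = 2 / (z \<bullet>c z)"
  have "(householder z *\<^sub>v x) $ i = (\<Sum>l<n. householder z $$ (i, l) * x $ l)"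
    using assms i by (intro index_mult_mat_vec_sum) auto
  also have "\<dots> = (\<Sum>l<n. (if i = l then x $ l else 0) - c * z $ i * (x $ l * cnj (z $ l)))"
    using assms i by (intro sum.cong) (auto simp: householder_def algebra_simps c_def)
  also have "\<dots> = x $ i - c * z $ i * (x \<bullet>c z)"
    using assms i by (simp add: sum_subtractf sum_distrib_left cscalar_prod_sum[of z n])
  finally show "(householder z *\<^sub>v x) $ i = (x - (2 / (z \<bullet>c z) * (x \<bullet>c z)) \<cdot>\<^sub>v z) $ i"
    using assms i unfolding c_def[symmetric] by simp
qed (use assms in \<open>simp add: householder_def\<close>)

lemma mat_eqI_mult_vec:
  fixes A B :: "'a :: comm_ring_1 mat"
  assumes A: "A \<in> carrier_mat m n" and B: "B \<in> carrier_mat m n"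
    and eq: "\<And>v. v \<in> carrier_vec n \<Longrightarrow> A *\<^sub>v v = B *\<^sub>v v"
  shows "A = B"
proof (rule eq_matI)
  fix i j assume "i < dim_row B" "j < dim_col B"
  then have i: "i < m" and j: "j < n" using B by auto
  have "A $$ (i, j) = (A *\<^sub>v unit_vec n j) $ i" using A i j by simp
  also have "\<dots> = B $$ (i, j)" using B i j by (simp add: eq)
  finally show "A $$ (i, j) = B $$ (i, j)" .
qed (use A B in auto)

lemma householder_involution:
  assumes z: "z \<in> carrier_vec n"
  shows "householder z * householder z = 1\<^sub>m n"
proof (rule mat_eqI_mult_vec[of _ n n])
  fix v :: "complex vec" assume v: "v \<in> carrier_vec n"
  define c where "c = 2 / (z \<bullet>c z)"
  define w where "w = v - (c * (v \<bullet>c z)) \<cdot>\<^sub>v z"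
  have w: "w \<in> carrier_vec n" using v z by (simp add: w_def)
  have "w \<bullet>c z = v \<bullet>c z - (c * (v \<bullet>c z) \<cdot>\<^sub>v z) \<bullet>c z"
    unfolding w_def using v z by (intro minus_scalar_prod_distrib) auto
  also have "\<dots> = v \<bullet>c z - c * (v \<bullet>c z) * (z \<bullet>c z)"
    using z by simp
  \<comment> \<open>Either \<open>z\<close> is zero and \<open>c = 0\<close>, or
    \<open>c * (z \<bullet>c z) = 2\<close> and the component along \<open>z\<close> changes sign.
    Both cases give the same relation after multiplication by \<open>c\<close>.\<close>
  also have "\<dots> = (if z \<bullet>c z = 0 then v \<bullet>c z else - (v \<bullet>c z))" by (simp add: c_def)
  finally have wz: "c * (w \<bullet>c z) = - (c * (v \<bullet>c z))" by (auto simp: c_def split: if_splits)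
  have "(householder z * householder z) *\<^sub>v v = householder z *\<^sub>v w"
    using v z by (subst assoc_mult_mat_vec[of _ n n _ n]) (auto simp: householder_mult_vec[of z n v] w_def c_def)
  also have "\<dots> = w - (c * (w \<bullet>c z)) \<cdot>\<^sub>v z" unfolding c_def using z w by (rule householder_mult_vec)
  also have "\<dots> = v" unfolding wz using v z by (intro eq_vecI) (auto simp: w_def)
  finally show "(householder z * householder z) *\<^sub>v v = 1\<^sub>m n *\<^sub>v v" using v by simp
qed (use z in \<open>auto intro: mult_carrier_mat householder_carrier\<close>)

lemma unitary_householder: "unitary_mat (householder z)"
  using householder_involution[of z "dim_vec z"]
  by (auto simp: unitary_mat_def householder_adjoint) (auto simp: householder_def)

text \<open>The two hypotheses make \<open>v - w\<close> have squared norm -2 times its product with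
  \<open>w\<close>, so the reflection subtracts -1 times \<open>v - w\<close> from \<open>w\<close>.
  Over the complex numbers equal norms leave a phase free; \<open>real\<close> removes it.\<close>

lemma householder_swaps:
  assumes v: "v \<in> carrier_vec n" and w: "w \<in> carrier_vec n"
    and norm: "v \<bullet>c v = w \<bullet>c w" and real: "v \<bullet>c w = w \<bullet>c v"
  shows "householder (v - w) *\<^sub>v w = v"
proof -
  let ?z = "v - w"
  have z: "?z \<in> carrier_vec n" using v w by simp
  have wz: "w \<bullet>c ?z = w \<bullet>c v - w \<bullet>c w"
    using v w by (simp add: cscalar_prod_sum[of _ n] sum_subtractf algebra_simps)
  have "?z \<bullet>c ?z = v \<bullet>c v - v \<bullet>c w - w \<bullet>c v + w \<bullet>c w"
    using v w by (simp add: cscalar_prod_sum[of _ n] sum_subtractf sum.distrib algebra_simps)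
  then have zz: "?z \<bullet>c ?z = - 2 * (w \<bullet>c ?z)" using wz norm real by simp
  show ?thesis
  proof (cases "?z \<bullet>c ?z = 0")
    case True
    then have "?z = 0\<^sub>v n" using z by simp
    then have "v = w" using v w
      by (metis index_minus_vec(1) index_zero_vec(1) carrier_vecD eq_vecI eq_iff_diff_eq_0)
    then show ?thesis using True v by (subst householder_mult_vec[OF z w]) (auto intro!: eq_vecI)
  next
    case False
    then have "2 / (?z \<bullet>c ?z) * (w \<bullet>c ?z) = - 1" using zz by (auto simp: field_simps)
    then show ?thesis using v w by (subst householder_mult_vec[OF z w]) (auto intro!: eq_vecI)
  qed
qed

subsection \<open>Unitary diagonalization of Hermitian matrices\<close>

lemma unitary_matD:
  assumes "unitary_mat U" "U \<in> carrier_mat n n"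
  shows "mat_adjoint U * U = 1\<^sub>m n" "U * mat_adjoint U = 1\<^sub>m n"
  using assms by (auto simp: unitary_mat_def)

lemma unitary_mat_mult:
  assumes U: "unitary_mat U" "U \<in> carrier_mat n n" and V: "unitary_mat V" "V \<in> carrier_mat n n"
  shows "unitary_mat (U * V)"
proof -
  have c[simp]: "U \<in> carrier_mat n n" "V \<in> carrier_mat n n" "mat_adjoint U \<in> carrier_mat n n"
    "mat_adjoint V \<in> carrier_mat n n" "dim_row U = n" "dim_col V = n" using U V by auto
  have "(U * V) * mat_adjoint (U * V) = U * (V * mat_adjoint V) * mat_adjoint U"
    by (simp add: mat_adjoint_mult[of U n n V n] assoc_mult_mat[of _ n n _ n _ n] mult_carrier_mat[of _ n n])
  also have "\<dots> = 1\<^sub>m n" using unitary_matD[OF U] unitary_matD[OF V]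
    by (simp add: right_mult_one_mat[of _ n n])
  finally have 1: "(U * V) * mat_adjoint (U * V) = 1\<^sub>m n" .
  then have "mat_adjoint (U * V) * (U * V) = 1\<^sub>m n"
    by (intro mat_mult_left_right_inverse[of "U * V" n "mat_adjoint (U * V)"]) (auto intro: mult_carrier_mat)
  then show ?thesis using 1 by (simp add: unitary_mat_def square_mat.simps)
qed

lemma mat_adjoint_four_block:
  fixes A B C D :: "complex mat"
  assumes "A \<in> carrier_mat m m" "B \<in> carrier_mat m n" "C \<in> carrier_mat n m" "D \<in> carrier_mat n n"
  shows "mat_adjoint (four_block_mat A B C D) =
    four_block_mat (mat_adjoint A) (mat_adjoint C) (mat_adjoint B) (mat_adjoint D)"
  using assms by (intro eq_matI) auto

text \<open>The real first coordinate is a choice of phase. It makes the inner product with the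
  first basis vector real, as \<open>householder_swaps\<close> demands.\<close>

lemma exists_eigenvector_unit:
  fixes A :: "complex mat"
  assumes A: "A \<in> carrier_mat (Suc n) (Suc n)"
  shows "\<exists>u l. u \<in> carrier_vec (Suc n) \<and> u \<bullet>c u = 1 \<and> A *\<^sub>v u = l \<cdot>\<^sub>v u \<and> cnj (u $ 0) = u $ 0"
proof -
  obtain as where as: "char_poly A = (\<Prod>a\<leftarrow>as. [:- a, 1:])" "length as = Suc n"
    using char_poly_factorized[OF A] by blast
  then obtain l ls where "as = l # ls" by (cases as) auto
  then have "eigenvalue A l" by (simp add: eigenvalue_root_char_poly[OF A] as)
  then obtain v where v: "v \<in> carrier_vec (Suc n)" "v \<noteq> 0\<^sub>v (Suc n)" "A *\<^sub>v v = l \<cdot>\<^sub>v v"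
    using A unfolding eigenvalue_def eigenvector_def by auto
  define r where "r = (\<Sum>i<Suc n. (cmod (v $ i))\<^sup>2)"
  have vv: "v \<bullet>c v = complex_of_real r"
    by (simp only: cscalar_prod_sum[OF v(1)] r_def of_real_sum complex_norm_square)
  then have "r \<noteq> 0" using v by auto
  moreover have "r \<ge> 0" unfolding r_def by (intro sum_nonneg) auto
  ultimately have r: "r > 0" by simp
  \<comment> \<open>Multiplying by \<open>p\<close> turns the first coordinate into its modulus. If
    that coordinate is 0, the formula would give 0 instead of a phase, hence the value 1.\<close>
  define p where "p = (if v $ 0 = 0 then 1 else cnj (v $ 0) / cmod (v $ 0))"
  have "cmod p = 1" by (simp add: p_def norm_divide)
  then have p: "p * cnj p = 1" "cnj (p * v $ 0) = p * v $ 0"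
    by (simp add: complex_norm_square[symmetric]) (simp add: p_def mult.commute)
  define c where "c = p / complex_of_real (sqrt r)"
  have cc: "c * cnj c = 1 / complex_of_real r"
    using p(1) r by (simp add: c_def of_real_mult[symmetric] del: of_real_mult)
  show ?thesis
  proof (intro exI conjI)
    show "c \<cdot>\<^sub>v v \<in> carrier_vec (Suc n)" using v by simp
    have "(c \<cdot>\<^sub>v v) \<bullet>c (c \<cdot>\<^sub>v v) = c * cnj c * (v \<bullet>c v)"
      using v by (simp add: conjugate_smult_vec)
    then show "(c \<cdot>\<^sub>v v) \<bullet>c (c \<cdot>\<^sub>v v) = 1" using r by (simp add: cc vv)
    show "A *\<^sub>v (c \<cdot>\<^sub>v v) = l \<cdot>\<^sub>v (c \<cdot>\<^sub>v v)"
      using A v by (simp add: mult_mat_vec smult_smult_assoc mult.commute)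
    show "cnj ((c \<cdot>\<^sub>v v) $ 0) = (c \<cdot>\<^sub>v v) $ 0"
      using v p(2) by (simp add: c_def)
  qed
qed

text \<open>Deflation: a reflection carries a unit eigenvector to the first basis vector.
  Hermiticity then clears the first row along with the first column, and the induction hypothesis
  applies to the remaining block.\<close>

theorem hermitian_unitarily_diagonalizable:
  fixes A :: "complex mat"
  assumes "A \<in> carrier_mat n n" "mat_adjoint A = A"
  shows "\<exists>V q. V \<in> carrier_mat n n \<and> unitary_mat V \<and>
    A = V * mat_diag n (\<lambda>i. complex_of_real (q i)) * mat_adjoint V"
  using assms
proof (induction n arbitrary: A)
  case 0
  then have "A = 1\<^sub>m 0 * mat_diag 0 (\<lambda>i. complex_of_real 0) * mat_adjoint (1\<^sub>m 0)" by (intro eq_matI) auto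
  moreover have "unitary_mat (1\<^sub>m 0)" by (simp add: unitary_mat_def)
  ultimately show ?case by (intro exI[of _ "1\<^sub>m 0"] exI[of _ "\<lambda>i. 0"]) simp
next
  case (Suc n)
  let ?N = "Suc n"
  note A = Suc.prems(1)
  obtain u l where u: "u \<in> carrier_vec ?N" "u \<bullet>c u = 1" "A *\<^sub>v u = l \<cdot>\<^sub>v u" "cnj (u $ 0) = u $ 0"
    using exists_eigenvector_unit[OF A] by blast
  define e :: "complex vec" where "e = unit_vec ?N 0"
  have e[simp]: "e \<in> carrier_vec ?N" by (simp add: e_def)
  define W where "W = householder (u - e)"
  have W[simp]: "W \<in> carrier_mat ?N ?N" using u by (simp add: W_def)
  have dimW[simp]: "dim_row W = ?N" "dim_col W = ?N" using carrier_matD[OF W] by auto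
  have Wadj: "mat_adjoint W = W" by (simp add: W_def householder_adjoint)
  have WW: "W * W = 1\<^sub>m ?N" using u by (simp add: W_def householder_involution[of _ ?N])
  have ue: "u \<bullet>c e = u $ 0" "e \<bullet>c u = cnj (u $ 0)" "e \<bullet>c e = 1"
    using u(1) by (simp_all add: cscalar_prod_sum[of _ ?N] e_def unit_vec_def if_distrib[of cnj]
      if_distrib[of "\<lambda>t. _ * t"] if_distrib[of "\<lambda>t. t * _"] cong: if_cong del: sum.lessThan_Suc)
  have We: "W *\<^sub>v e = u"
    unfolding W_def using u by (intro householder_swaps) (auto simp: ue)
  have Wu: "W *\<^sub>v u = e"
    using WW We assoc_mult_mat_vec[OF W W e] by simp
  define B where "B = W * A * W"
  have B: "B \<in> carrier_mat ?N ?N" using A by (auto simp: B_def intro: mult_carrier_mat)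
  have Badj: "mat_adjoint B = B"
    using A Suc.prems(2)
    by (simp add: B_def mat_adjoint_mult[of _ ?N ?N _ ?N] mult_carrier_mat[of _ ?N ?N] Wadj assoc_mult_mat[of _ ?N ?N _ ?N _ ?N])
  have "B *\<^sub>v e = W *\<^sub>v (A *\<^sub>v (W *\<^sub>v e))"
    using A by (simp add: B_def assoc_mult_mat_vec[of _ ?N ?N _ ?N] mult_carrier_mat[of _ ?N ?N]
      mult_mat_vec_carrier[of _ ?N ?N])
  also have "\<dots> = l \<cdot>\<^sub>v e" using u by (simp add: We Wu mult_mat_vec[of _ ?N ?N])
  finally have Be: "B *\<^sub>v e = l \<cdot>\<^sub>v e" .
  have col0: "B $$ (i, 0) = (if i = 0 then l else 0)" if "i < ?N" for i
  proof -
    have "B $$ (i, 0) = (B *\<^sub>v e) $ i" using B that by (simp add: e_def)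
    then show ?thesis using that by (simp add: Be) (simp add: e_def)
  qed
  have row0: "B $$ (0, j) = (if j = 0 then cnj l else 0)" if "j < ?N" for j
    using col0[OF that] B that by (subst Badj[symmetric]) auto
  \<comment> \<open>The corner entry is \<open>l\<close> when read from the column and
    \<open>cnj l\<close> when read from the row, so the eigenvalue is real.\<close>
  have l: "l = complex_of_real (Re l)" using col0[of 0] row0[of 0] by (simp add: complex_eq_iff)
  then have lc: "cnj l = l" by (metis complex_cnj_complex_of_real)
  define C where "C = mat n n (\<lambda>(i, j). B $$ (Suc i, Suc j))"
  have C: "C \<in> carrier_mat n n" by (simp add: C_def)
  have Cadj: "mat_adjoint C = C"
    using B by (intro eq_matI) (simp_all add: C_def, subst (2) Badj[symmetric], simp)
  obtain V q where V: "V \<in> carrier_mat n n" "unitary_mat V"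
    and Ceq: "C = V * mat_diag n (\<lambda>i. complex_of_real (q i)) * mat_adjoint V"
    using Suc.IH[OF C Cadj] by blast
  let ?D = "mat_diag n (\<lambda>i. complex_of_real (q i))"
  let ?L = "mat_diag 1 (\<lambda>i. l)"
  let ?F = "four_block_mat (1\<^sub>m 1) (0\<^sub>m 1 n) (0\<^sub>m n 1) V"
  let ?E = "four_block_mat ?L (0\<^sub>m 1 n) (0\<^sub>m n 1) ?D"
  have zadj: "mat_adjoint (0\<^sub>m a b :: complex mat) = 0\<^sub>m b a" for a b by (intro eq_matI) auto
  have F: "?F \<in> carrier_mat ?N ?N" using V four_block_carrier_mat[of "1\<^sub>m 1" 1 1 V n n] by simp
  have Fadj: "mat_adjoint ?F = four_block_mat (1\<^sub>m 1) (0\<^sub>m 1 n) (0\<^sub>m n 1) (mat_adjoint V)"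
    using V by (subst mat_adjoint_four_block[of _ 1 _ n]) (auto simp: zadj)
  have id: "four_block_mat (1\<^sub>m 1) (0\<^sub>m 1 n) (0\<^sub>m n 1) (1\<^sub>m n) = (1\<^sub>m ?N :: complex mat)"
    by (intro eq_matI) auto
  have FF: "mat_adjoint ?F * ?F = 1\<^sub>m ?N" "?F * mat_adjoint ?F = 1\<^sub>m ?N"
    using V unitary_matD[OF V(2,1)] unfolding Fadj
    by (subst mult_four_block_mat[of _ 1 1 _ n _ n _ _ 1 _ n]; auto simp: id)+
  have Fu: "unitary_mat ?F" using F FF V(1) unfolding unitary_mat_def by auto
  have E: "?E = mat_diag ?N (\<lambda>i. complex_of_real (case i of 0 \<Rightarrow> Re l | Suc k \<Rightarrow> q k))"
    using l by (intro eq_matI) (auto simp: mat_diag_def split: nat.splits)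
  have Bblock: "B = four_block_mat ?L (0\<^sub>m 1 n) (0\<^sub>m n 1) C"
    using B by (intro eq_matI) (auto simp: col0 row0 lc C_def mat_diag_def)
  have cs: "V * ?D \<in> carrier_mat n n" using V by (auto intro: mult_carrier_mat)
  have "?F * ?E = four_block_mat ?L (0\<^sub>m 1 n) (0\<^sub>m n 1) (V * ?D)"
    using V left_mult_one_mat[of ?L 1 1] left_mult_zero_mat[of ?L 1 1 n] left_mult_zero_mat[of ?D n n 1]
    by (subst mult_four_block_mat[of _ 1 1 _ n _ n _ _ 1 _ n]) auto
  then have "?F * ?E * mat_adjoint ?F = four_block_mat ?L (0\<^sub>m 1 n) (0\<^sub>m n 1) C"
    unfolding Fadj Ceq
    using V cs right_mult_one_mat[of ?L 1 1] left_mult_zero_mat[of "mat_adjoint V" n n 1]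
      right_mult_zero_mat[of "V * ?D" n n 1] right_mult_zero_mat[of ?L 1 1 n]
    by (simp only:) (subst mult_four_block_mat[of _ 1 1 _ n _ n _ _ 1 _ n], auto)
  then have BF: "B = ?F * ?E * mat_adjoint ?F" using Bblock by simp
  let ?U = "W * ?F"
  have Ec: "?E \<in> carrier_mat ?N ?N" unfolding E by simp
  have Fac: "mat_adjoint ?F \<in> carrier_mat ?N ?N" using F by simp
  have "A = W * B * W"
  proof -
    have "W * B * W = (W * W) * A * (W * W)"
      using A by (simp add: B_def assoc_mult_mat[of _ ?N ?N _ ?N _ ?N] mult_carrier_mat[of _ ?N ?N] del: WW)
    then show ?thesis using A by (simp add: WW)
  qed
  also have "\<dots> = ?U * ?E * mat_adjoint ?U"
    unfolding BF mat_adjoint_mult[OF W F] Wadj using F Ec Fac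
    by (simp add: assoc_mult_mat[of _ ?N ?N _ ?N _ ?N] mult_carrier_mat[of _ ?N ?N])
  finally have "A = ?U * ?E * mat_adjoint ?U" .
  moreover have "?U \<in> carrier_mat ?N ?N" using W F by (rule mult_carrier_mat)
  moreover have "unitary_mat ?U"
    using unitary_householder[of "u - e", folded W_def] W Fu F by (rule unitary_mat_mult)
  ultimately show ?case unfolding E by blast
qed

subsection \<open>Spectral projections and the time average\<close>

text \<open>Each projection fixes the range of the other, so \<open>P * Q = Q\<close> and
  \<open>Q * P = P\<close>; the adjoint of the second equation reads \<open>P * Q = P\<close>. This
  justifies the \<open>THE\<close> in \<open>spectral_proj\<close>.\<close>

lemma is_orth_proj_unique:
  assumes P: "is_orth_proj n P W" and Q: "is_orth_proj n Q W"
  shows "P = Q"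
proof -
  have absorb: "P * Q = Q" if P: "is_orth_proj n P W" and Q: "is_orth_proj n Q W" for P Q
  proof (rule mat_eqI_mult_vec[of _ n n])
    have c: "P \<in> carrier_mat n n" "Q \<in> carrier_mat n n" using P Q by (auto simp: is_orth_proj_def)
    then show "P * Q \<in> carrier_mat n n" "Q \<in> carrier_mat n n" by auto
    fix v :: "complex vec" assume v: "v \<in> carrier_vec n"
    then have "Q *\<^sub>v v \<in> (\<lambda>v. P *\<^sub>v v) ` carrier_vec n" using P Q by (auto simp: is_orth_proj_def)
    then obtain w where w: "w \<in> carrier_vec n" "Q *\<^sub>v v = P *\<^sub>v w" by blast
    have "(P * Q) *\<^sub>v v = P *\<^sub>v (P *\<^sub>v w)" using c v w(2) by simp
    also have "\<dots> = (P * P) *\<^sub>v w" using c w(1) by simp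
    also have "\<dots> = Q *\<^sub>v v" using P w(2) by (simp add: is_orth_proj_def)
    finally show "(P * Q) *\<^sub>v v = Q *\<^sub>v v" .
  qed
  have "P = mat_adjoint (Q * P)" using absorb[OF Q P] P by (simp add: is_orth_proj_def)
  also have "\<dots> = P * Q" using P Q by (simp add: is_orth_proj_def mat_adjoint_mult[of _ n n _ n])
  also have "\<dots> = Q" by (rule absorb[OF P Q])
  finally show ?thesis .
qed

lemma mat_adjoint_mat_diag: "mat_adjoint (mat_diag n f) = mat_diag n (\<lambda>i. cnj (f i))"
  by (intro eq_matI) (auto simp: mat_diag_def)

lemma mat_diag_mult_vec:
  fixes x :: "'a :: semiring_1 vec"
  assumes "x \<in> carrier_vec n" "i < n"
  shows "(mat_diag n f *\<^sub>v x) $ i = f i * x $ i"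
proof -
  have "(mat_diag n f *\<^sub>v x) $ i = (\<Sum>l<n. mat_diag n f $$ (i, l) * x $ l)"
    using assms by (simp add: mat_diag_def scalar_prod_def lessThan_atLeast0)
  also have "\<dots> = (\<Sum>l<n. if l = i then f i * x $ i else 0)"
    using assms by (intro sum.cong) (auto simp: mat_diag_def)
  finally show ?thesis using assms by simp
qed

text \<open>An eigenbasis is fixed once, as the columns of \<open>V\<close>. The function
  \<open>q\<close> lists the eigenvalues with multiplicity, so \<open>q i = q j\<close> with
  \<open>i \<noteq> j\<close> records a degeneracy.\<close>

locale diagonalized =
  fixes n :: nat and A V :: "complex mat" and q :: "nat \<Rightarrow> real"
  assumes V_carrier [simp]: "V \<in> carrier_mat n n" and V_unitary: "unitary_mat V"
    and A_eq: "A = V * mat_diag n (\<lambda>i. complex_of_real (q i)) * mat_adjoint V"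
begin

abbreviation D :: "complex mat" where "D \<equiv> mat_diag n (\<lambda>i. complex_of_real (q i))"

definition rotate_basis :: "complex mat \<Rightarrow> complex mat" where
  "rotate_basis B = mat_adjoint V * B * V"

lemma V_adjoint_carrier [simp]: "mat_adjoint V \<in> carrier_mat n n"
  by simp

lemma V_dim [simp]: "dim_row V = n" "dim_col V = n"
  using carrier_matD[OF V_carrier] by auto

lemma V_unit: "mat_adjoint V * V = 1\<^sub>m n" "V * mat_adjoint V = 1\<^sub>m n"
  using unitary_matD[OF V_unitary V_carrier] by auto

lemma A_carrier [simp]: "A \<in> carrier_mat n n"
  unfolding A_eq by (simp add: mult_carrier_mat[of _ n n])

lemma A_dim [simp]: "dim_row A = n" "dim_col A = n"
  using carrier_matD[OF A_carrier] by auto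

lemma rotate_basis_carrier [simp]: "B \<in> carrier_mat n n \<Longrightarrow> rotate_basis B \<in> carrier_mat n n"
  by (simp add: rotate_basis_def mult_carrier_mat[of _ n n])

lemmas assoc = assoc_mult_mat[of _ n n _ n _ n] mult_carrier_mat[of _ n n]

lemma V_cancel:
  assumes "B \<in> carrier_mat n n"
  shows "mat_adjoint V * (V * B) = B" "V * (mat_adjoint V * B) = B"
  using assms by (simp_all add: assoc_mult_mat[of _ n n _ n _ n, symmetric] V_unit)

lemma rotate_basis_mult:
  assumes "B \<in> carrier_mat n n" "C \<in> carrier_mat n n"
  shows "rotate_basis (B * C) = rotate_basis B * rotate_basis C"
  using assms by (simp add: rotate_basis_def assoc V_cancel)

lemma rotate_basis_conj:
  assumes "B \<in> carrier_mat n n"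
  shows "rotate_basis (V * B * mat_adjoint V) = B"
  using assms by (simp add: rotate_basis_def assoc V_cancel V_unit)

lemma rotate_basis_A: "rotate_basis A = D"
  unfolding A_eq by (rule rotate_basis_conj) simp

lemma trace_rotate_basis:
  assumes "B \<in> carrier_mat n n"
  shows "trace_mat (rotate_basis B) = trace_mat B"
proof -
  have "trace_mat (rotate_basis B) = trace_mat (V * (mat_adjoint V * B))"
    unfolding rotate_basis_def using assms by (intro trace_mat_mult_comm) (auto intro: mult_carrier_mat)
  then show ?thesis using assms by (simp add: V_cancel)
qed

lemma V_adjoint_mult_A: "mat_adjoint V * A = D * mat_adjoint V"
  unfolding A_eq by (simp add: assoc V_cancel)

text \<open>In the coordinates given by \<open>V\<close> the matrix is diagonal, so the eigenvalue
  equation only restricts the support of the coordinate vector. The zero vector and values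
  \<open>l\<close> outside the spectrum are covered, so this describes all of
  \<open>eigenspace A l\<close>.\<close>

lemma eigenvector_iff:
  assumes v: "v \<in> carrier_vec n"
  shows "A *\<^sub>v v = l \<cdot>\<^sub>v v \<longleftrightarrow>
    (\<forall>i<n. (mat_adjoint V *\<^sub>v v) $ i \<noteq> 0 \<longrightarrow> l = complex_of_real (q i))" (is "?L = ?R")
proof -
  let ?x = "mat_adjoint V *\<^sub>v v"
  have x: "?x \<in> carrier_vec n" by (rule mult_mat_vec_carrier[OF V_adjoint_carrier v])
  have Av: "mat_adjoint V *\<^sub>v (A *\<^sub>v v) = D *\<^sub>v ?x"
    using v by (simp add: assoc_mult_mat_vec[of _ n n _ n, symmetric] V_adjoint_mult_A)
  have lv: "mat_adjoint V *\<^sub>v (l \<cdot>\<^sub>v v) = l \<cdot>\<^sub>v ?x"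
    using v by (simp add: mult_mat_vec[of _ n n])
  have "?L \<longleftrightarrow> D *\<^sub>v ?x = l \<cdot>\<^sub>v ?x"
  proof
    assume "D *\<^sub>v ?x = l \<cdot>\<^sub>v ?x"
    then have "V *\<^sub>v (mat_adjoint V *\<^sub>v (A *\<^sub>v v)) = V *\<^sub>v (mat_adjoint V *\<^sub>v (l \<cdot>\<^sub>v v))"
      by (simp add: Av lv)
    then show ?L using v
      by (simp add: assoc_mult_mat_vec[of V n n "mat_adjoint V" n, symmetric] V_unit mult_mat_vec_carrier[of A n n])
  qed (use Av lv in simp)
  also have "\<dots> \<longleftrightarrow> (\<forall>i<n. complex_of_real (q i) * ?x $ i = l * ?x $ i)"
  proof -
    have D: "(D *\<^sub>v ?x) $ i = complex_of_real (q i) * ?x $ i" if "i < n" for i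
      using x that by (rule mat_diag_mult_vec)
    show ?thesis
    proof
      assume "D *\<^sub>v ?x = l \<cdot>\<^sub>v ?x"
      then have "(D *\<^sub>v ?x) $ i = (l \<cdot>\<^sub>v ?x) $ i" for i by simp
      then show "\<forall>i<n. complex_of_real (q i) * ?x $ i = l * ?x $ i"
        using D by (metis index_smult_vec(1) carrier_vecD x)
    next
      assume "\<forall>i<n. complex_of_real (q i) * ?x $ i = l * ?x $ i"
      then show "D *\<^sub>v ?x = l \<cdot>\<^sub>v ?x"
        using x D by (intro eq_vecI) (auto simp: mat_diag_def simp del: index_mult_mat_vec)
    qed
  qed
  also have "\<dots> \<longleftrightarrow> ?R" by auto
  finally show ?thesis .
qed

lemma eigenvalues: "{l. eigenvalue A l} = (\<lambda>i. complex_of_real (q i)) ` {..<n}"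
proof (intro equalityI subsetI)
  fix l assume "l \<in> {l. eigenvalue A l}"
  then obtain v where v: "v \<in> carrier_vec n" "v \<noteq> 0\<^sub>v n" "A *\<^sub>v v = l \<cdot>\<^sub>v v"
    by (auto simp: eigenvalue_def eigenvector_def)
  have "mat_adjoint V *\<^sub>v v \<noteq> 0\<^sub>v n"
  proof
    assume "mat_adjoint V *\<^sub>v v = 0\<^sub>v n"
    then have "V *\<^sub>v (mat_adjoint V *\<^sub>v v) = 0\<^sub>v n" by (auto intro!: eq_vecI)
    then show False using v V_unit by (simp add: assoc_mult_mat_vec[of _ n n _ n, symmetric])
  qed
  then obtain i where "i < n" "(mat_adjoint V *\<^sub>v v) $ i \<noteq> 0"
    using v(1) by (metis V_adjoint_carrier carrier_vecD eq_vecI index_zero_vec mult_mat_vec_carrier)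
  then show "l \<in> (\<lambda>i. complex_of_real (q i)) ` {..<n}" using v eigenvector_iff by blast
next
  fix l assume "l \<in> (\<lambda>i. complex_of_real (q i)) ` {..<n}"
  then obtain i where i: "i < n" "l = complex_of_real (q i)" by auto
  let ?v = "V *\<^sub>v unit_vec n i"
  have v: "?v \<in> carrier_vec n" by (rule mult_mat_vec_carrier[OF V_carrier unit_vec_carrier])
  have x: "mat_adjoint V *\<^sub>v ?v = unit_vec n i"
    by (simp add: assoc_mult_mat_vec[of _ n n _ n, symmetric] V_unit)
  have "A *\<^sub>v ?v = l \<cdot>\<^sub>v ?v" unfolding eigenvector_iff[OF v] x using i by (auto simp: unit_vec_def)
  moreover have "?v \<noteq> 0\<^sub>v n"
  proof
    assume "?v = 0\<^sub>v n"
    then have "mat_adjoint V *\<^sub>v ?v = 0\<^sub>v n" by (auto intro!: eq_vecI)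
    then show False using i unfolding x by (metis index_unit_vec(1) index_zero_vec(1) zero_neq_one)
  qed
  ultimately show "l \<in> {l. eigenvalue A l}" using v
    by (auto simp: eigenvalue_def eigenvector_def)
qed

definition level_proj :: "complex \<Rightarrow> complex mat" where
  "level_proj l = mat_diag n (\<lambda>i. if complex_of_real (q i) = l then 1 else 0)"

text \<open>The right-hand side is checked to be an orthogonal projection with range
  \<open>eigenspace A l\<close>; uniqueness then evaluates the \<open>THE\<close>.\<close>

lemma spectral_proj_eq: "spectral_proj A l = V * level_proj l * mat_adjoint V"
proof -
  let ?P = "V * level_proj l * mat_adjoint V"
  have L: "level_proj l \<in> carrier_mat n n" "level_proj l * level_proj l = level_proj l"
    "mat_adjoint (level_proj l) = level_proj l"
    by (auto simp: level_proj_def mat_adjoint_mat_diag if_distrib cong: if_cong)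
  have P: "?P \<in> carrier_mat n n" using L by (simp add: assoc)
  have Px: "mat_adjoint V *\<^sub>v (?P *\<^sub>v v) = level_proj l *\<^sub>v (mat_adjoint V *\<^sub>v v)"
    if "v \<in> carrier_vec n" for v
  proof -
    have "mat_adjoint V * ?P = level_proj l * mat_adjoint V" using L(1) by (simp add: assoc V_cancel)
    then show ?thesis using that L(1) P by (simp add: assoc_mult_mat_vec[of _ n n _ n, symmetric])
  qed
  have Lx: "(level_proj l *\<^sub>v x) $ i = (if complex_of_real (q i) = l then x $ i else 0)"
    if "i < n" "x \<in> carrier_vec n" for x i
    using that by (simp add: level_proj_def mat_diag_mult_vec del: index_mult_mat_vec)
  have "is_orth_proj n ?P (eigenspace A l)"
    unfolding is_orth_proj_def
  proof (intro conjI)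
    show "?P * ?P = ?P" using L
      by (simp add: assoc V_cancel) (simp add: assoc_mult_mat[of _ n n _ n _ n, symmetric] L(2) assoc(2))
    show "mat_adjoint ?P = ?P" using L by (simp add: mat_adjoint_mult[of _ n n _ n] assoc)
    show "(\<lambda>v. ?P *\<^sub>v v) ` carrier_vec n = eigenspace A l"
    proof (intro equalityI subsetI)
      fix w assume "w \<in> (\<lambda>v. ?P *\<^sub>v v) ` carrier_vec n"
      then obtain v where v: "v \<in> carrier_vec n" "w = ?P *\<^sub>v v" by blast
      have w: "w \<in> carrier_vec n" using P v by (auto intro: mult_mat_vec_carrier)
      have "A *\<^sub>v w = l \<cdot>\<^sub>v w" unfolding eigenvector_iff[OF w]
        using v mult_mat_vec_carrier[OF V_adjoint_carrier v(1)]
        by (auto simp: Px Lx simp del: index_mult_mat_vec)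
      then show "w \<in> eigenspace A l" using w by (simp add: eigenspace_def)
    next
      fix w assume "w \<in> eigenspace A l"
      then have w: "w \<in> carrier_vec n" "A *\<^sub>v w = l \<cdot>\<^sub>v w" by (auto simp: eigenspace_def)
      have x: "mat_adjoint V *\<^sub>v w \<in> carrier_vec n" using mult_mat_vec_carrier[OF V_adjoint_carrier w(1)] .
      have "level_proj l *\<^sub>v (mat_adjoint V *\<^sub>v w) = mat_adjoint V *\<^sub>v w"
        using w(2) x unfolding eigenvector_iff[OF w(1)]
        by (intro eq_vecI) (auto simp: Lx carrier_matD(1)[OF L(1)] simp del: index_mult_mat_vec)
      then have "?P *\<^sub>v w = w"
        using w(1) x L(1) assoc_mult_mat_vec[OF mult_carrier_mat[OF V_carrier L(1)] V_adjoint_carrier w(1)]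
          assoc_mult_mat_vec[OF V_carrier L(1) x] assoc_mult_mat_vec[OF V_carrier V_adjoint_carrier w(1)]
        by (simp add: V_unit(2))
      then show "w \<in> (\<lambda>v. ?P *\<^sub>v v) ` carrier_vec n" using w(1) by (metis image_eqI)
    qed
  qed (rule P)
  then show ?thesis unfolding spectral_proj_def using is_orth_proj_unique by simp blast
qed

lemma time_average_eq:
  assumes B: "B \<in> carrier_mat n n"
  shows "time_average A B = V * mat n n (\<lambda>(i, j). if q i = q j then rotate_basis B $$ (i, j) else 0) * mat_adjoint V"
    (is "_ = V * ?S * _")
proof (rule eq_matI)
  have S: "?S \<in> carrier_mat n n" by simp
  have conj: "(V * C * mat_adjoint V) $$ (a, b) = (\<Sum>i<n. \<Sum>j<n. V $$ (a, j) * C $$ (j, i) * cnj (V $$ (b, i)))"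
    if "C \<in> carrier_mat n n" "a < n" "b < n" for C a b
    using that by (subst index_mult_mat_sum[of _ n n _ n], simp_all add: assoc(2) del: index_mult_mat(1))
      (auto simp: index_mult_mat_sum[of _ n n _ n] sum_distrib_right simp del: index_mult_mat(1) intro!: sum.cong)
  fix a b assume "a < dim_row (V * ?S * mat_adjoint V)" "b < dim_col (V * ?S * mat_adjoint V)"
  then have ab: "a < n" "b < n" by auto
  let ?ev = "(\<lambda>i. complex_of_real (q i)) ` {..<n}"
  have PBP: "spectral_proj A l * B * spectral_proj A l =
      V * (level_proj l * rotate_basis B * level_proj l) * mat_adjoint V" for l
  proof -
    have "level_proj l \<in> carrier_mat n n" by (simp add: level_proj_def)
    then show ?thesis using B unfolding spectral_proj_eq rotate_basis_def by (simp add: assoc)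
  qed
  have LRL: "level_proj l * rotate_basis B * level_proj l = mat n n (\<lambda>(i, j).
      if complex_of_real (q i) = l \<and> complex_of_real (q j) = l then rotate_basis B $$ (i, j) else 0)" for l
    unfolding level_proj_def using B
    by (subst mat_diag_mult_left[of _ n n], simp, subst mat_diag_mult_right[of _ n n]) (auto intro!: eq_matI)
  have "time_average A B $$ (a, b) = (\<Sum>l\<in>?ev. \<Sum>i<n. \<Sum>j<n.
     V $$ (a, j) * (if complex_of_real (q j) = l \<and> complex_of_real (q i) = l then rotate_basis B $$ (j, i) else 0) * cnj (V $$ (b, i)))"
    using ab by (simp add: time_average_def eigenvalues PBP LRL conj del: index_mult_mat(1))
  also have "\<dots> = (\<Sum>i<n. \<Sum>j<n. \<Sum>l\<in>?ev.
     V $$ (a, j) * (if complex_of_real (q j) = l \<and> complex_of_real (q i) = l then rotate_basis B $$ (j, i) else 0) * cnj (V $$ (b, i)))"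
    by (rule trans[OF sum.swap], rule sum.cong[OF refl], rule sum.swap)
  also have "\<dots> = (\<Sum>i<n. \<Sum>j<n. V $$ (a, j) * ?S $$ (j, i) * cnj (V $$ (b, i)))"
  proof (intro sum.cong refl)
    fix i j assume ij: "i \<in> {..<n}" "j \<in> {..<n}"
    \<comment> \<open>The sum runs over the set of distinct eigenvalues, so an entry with
      \<open>q i = q j\<close> is kept exactly once, at \<open>l = q j\<close>, and every other
      entry is lost.\<close>
    have "(\<Sum>l\<in>?ev. V $$ (a, j) * (if complex_of_real (q j) = l \<and> complex_of_real (q i) = l then rotate_basis B $$ (j, i) else 0) * cnj (V $$ (b, i)))
      = (\<Sum>l\<in>?ev. if l = complex_of_real (q j) then V $$ (a, j) * ?S $$ (j, i) * cnj (V $$ (b, i)) else 0)"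
      using ij by (intro sum.cong) auto
    also have "\<dots> = V $$ (a, j) * ?S $$ (j, i) * cnj (V $$ (b, i))"
      using ij by (subst sum.delta) auto
    finally show "(\<Sum>l\<in>?ev. V $$ (a, j) * (if complex_of_real (q j) = l \<and> complex_of_real (q i) = l then rotate_basis B $$ (j, i) else 0) * cnj (V $$ (b, i)))
      = V $$ (a, j) * ?S $$ (j, i) * cnj (V $$ (b, i))" .
  qed
  also have "\<dots> = (V * ?S * mat_adjoint V) $$ (a, b)" using conj[OF S ab] by simp
  finally show "time_average A B $$ (a, b) = (V * ?S * mat_adjoint V) $$ (a, b)" .
qed (simp_all add: time_average_def)

lemma time_average_eq_iff:
  assumes B: "B \<in> carrier_mat n n"
  shows "time_average A B = A \<longleftrightarrow>
    (\<forall>i<n. \<forall>j<n. q i = q j \<longrightarrow> rotate_basis B $$ (i, j) = (if i = j then complex_of_real (q i) else 0))"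
    (is "_ \<longleftrightarrow> ?R")
proof -
  let ?S = "mat n n (\<lambda>(i, j). if q i = q j then rotate_basis B $$ (i, j) else 0)"
  have "time_average A B = A \<longleftrightarrow> V * ?S * mat_adjoint V = V * D * mat_adjoint V"
    by (simp add: time_average_eq[OF B] A_eq[symmetric])
  also have "\<dots> \<longleftrightarrow> ?S = D"
  proof
    assume "V * ?S * mat_adjoint V = V * D * mat_adjoint V"
    then have "rotate_basis (V * ?S * mat_adjoint V) = rotate_basis (V * D * mat_adjoint V)" by simp
    then show "?S = D" by (simp add: rotate_basis_conj)
  qed simp
  also have "\<dots> \<longleftrightarrow> (\<forall>i<n. \<forall>j<n. ?S $$ (i, j) = D $$ (i, j))"
    by (auto simp: mat_eq_iff mat_diag_def)
  also have "\<dots> \<longleftrightarrow> ?R" by (auto simp: mat_diag_def)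
  finally show ?thesis .
qed

text \<open>Commuting with \<open>A\<close> means \<open>(q i - q j) * Y_ij = 0\<close> in the
  eigenbasis, so \<open>Y\<close> is block diagonal. The trace then sees only the entries of
  \<open>B\<close> inside the blocks, and there the hypothesis on the time average makes them those
  of \<open>A\<close>.\<close>

lemma trace_eq_of_time_average:
  assumes B: "B \<in> carrier_mat n n" and avg: "time_average A B = A"
    and Y: "Y \<in> carrier_mat n n" and comm: "A * Y = Y * A"
  shows "trace_mat (B * Y) = trace_mat (A * Y)"
proof -
  have "D * rotate_basis Y = rotate_basis Y * D"
    using rotate_basis_mult[OF A_carrier Y] rotate_basis_mult[OF Y A_carrier] comm by (simp add: rotate_basis_A)
  then have comm_ij: "(D * rotate_basis Y) $$ (i, j) = (rotate_basis Y * D) $$ (i, j)" for i j by simp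
  then have offdiag: "rotate_basis Y $$ (i, j) = 0" if "i < n" "j < n" "q i \<noteq> q j" for i j
  proof -
    have R: "rotate_basis Y \<in> carrier_mat n n" using Y by simp
    have "complex_of_real (q i) * rotate_basis Y $$ (i, j) = rotate_basis Y $$ (i, j) * complex_of_real (q j)"
      using comm_ij[of i j] that(1,2)
      unfolding mat_diag_mult_left[OF R] mat_diag_mult_right[OF R] by simp
    then show ?thesis using that(3) by (simp add: mult.commute)
  qed
  have tr: "trace_mat (C * rotate_basis Y) = (\<Sum>i<n. \<Sum>j<n. C $$ (i, j) * rotate_basis Y $$ (j, i))"
    if C: "C \<in> carrier_mat n n" for C
    using C Y by (simp add: trace_mat_def index_mult_mat_sum[of _ n n _ n] del: index_mult_mat(1))
  have "trace_mat (B * Y) = trace_mat (rotate_basis B * rotate_basis Y)"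
    using B Y by (simp add: rotate_basis_mult[symmetric] trace_rotate_basis assoc(2))
  also have "\<dots> = trace_mat (D * rotate_basis Y)"
    unfolding tr[OF rotate_basis_carrier[OF B]] tr[OF mat_diag_dim]
  proof (intro sum.cong refl)
    fix i j assume "i \<in> {..<n}" "j \<in> {..<n}"
    then have ij: "i < n" "j < n" by auto
    show "rotate_basis B $$ (i, j) * rotate_basis Y $$ (j, i) = D $$ (i, j) * rotate_basis Y $$ (j, i)"
    proof (cases "q i = q j")
      case True
      then have "rotate_basis B $$ (i, j) = (if i = j then complex_of_real (q i) else 0)"
        using avg time_average_eq_iff[OF B] ij by blast
      then show ?thesis using ij by (simp add: mat_diag_def)
    next
      case False
      then show ?thesis using offdiag[OF ij(2,1)] by simp
    qed
  qed
  also have "\<dots> = trace_mat (A * Y)"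
    using Y by (simp add: rotate_basis_A[symmetric] rotate_basis_mult[symmetric] trace_rotate_basis assoc(2))
  finally show ?thesis .
qed

end

subsection \<open>Kronecker products and partial traces\<close>

lemma sum_lessThan_mult:
  fixes f :: "nat \<Rightarrow> 'a :: comm_monoid_add"
  shows "(\<Sum>a<n * k. f a) = (\<Sum>i<n. \<Sum>p<k. f (i * k + p))"
proof -
  have "(\<Sum>p<k. f (i * k + p)) = sum f {i * k..<i * k + k}" for i
    using sum.shift_bounds_nat_ivl[of f 0 "i * k" k] by (simp add: lessThan_atLeast0 add.commute)
  then show ?thesis by (simp add: sum.nat_group)
qed

lemma pair_index_less:
  assumes "i < n" "p < (k :: nat)"
  shows "i * k + p < n * k"
proof -
  have "i * k + p < Suc i * k" using assms by simp
  also have "\<dots> \<le> n * k" using assms by (intro mult_le_mono1) simp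
  finally show ?thesis .
qed

lemma kronecker_carrier [simp]:
  "A \<in> carrier_mat a a' \<Longrightarrow> B \<in> carrier_mat b b' \<Longrightarrow> kronecker A B \<in> carrier_mat (a * b) (a' * b')"
  by (auto simp: kronecker_def)

lemma kronecker_index:
  assumes "A \<in> carrier_mat a a'" "B \<in> carrier_mat b b'" "x < a * b" "y < a' * b'"
  shows "kronecker A B $$ (x, y) = A $$ (x div b, y div b') * B $$ (x mod b, y mod b')"
  using assms by (auto simp: kronecker_def)

lemma kronecker_index_pair:
  assumes "A \<in> carrier_mat a a'" "B \<in> carrier_mat b b'" "i < a" "p < b" "j < a'" "q < b'"
  shows "kronecker A B $$ (i * b + p, j * b' + q) = A $$ (i, j) * B $$ (p, q)"
  using assms by (simp add: kronecker_index[of _ a a' _ b b'] pair_index_less)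

text \<open>The composite associates to the left. The comparison of the two states needs ancilla and
  qubit grouped as one factor, whereas statements about the qubit need it split off as the last
  factor.\<close>

lemma kronecker_assoc: "kronecker (kronecker A B) C = kronecker A (kronecker B C)"
proof (rule eq_matI)
  show "dim_row (kronecker (kronecker A B) C) = dim_row (kronecker A (kronecker B C))"
    "dim_col (kronecker (kronecker A B) C) = dim_col (kronecker A (kronecker B C))"
    by (simp_all add: kronecker_def)
  fix x y assume "x < dim_row (kronecker A (kronecker B C))" "y < dim_col (kronecker A (kronecker B C))"
  then have x: "x < dim_row A * (dim_row B * dim_row C)" and y: "y < dim_col A * (dim_col B * dim_col C)"
    by (simp_all add: kronecker_def)
  have aux: "x div c < a * b \<and> x mod (b * c) < b * c \<and> x div c div b = x div (b * c) \<and>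
      x div c mod b = x mod (b * c) div c \<and> x mod c = x mod (b * c) mod c"
    if "x < a * (b * c)" for x a b c :: nat
  proof (intro conjI)
    have bc: "b * c > 0" using that by (cases "b * c = 0") auto
    show "x div c < a * b" using that bc by (simp add: less_mult_imp_div_less mult.assoc)
    show "x mod (b * c) < b * c" using bc by simp
    show "x div c div b = x div (b * c)" by (metis div_mult2_eq mult.commute)
    show "x div c mod b = x mod (b * c) div c"
      using bc by (simp add: mod_mult2_eq[of x c b] mult.commute[of b c])
    show "x mod c = x mod (b * c) mod c" by (simp add: mod_mod_cancel)
  qed
  show "kronecker (kronecker A B) C $$ (x, y) = kronecker A (kronecker B C) $$ (x, y)"
    using x y aux[OF x] aux[OF y] by (simp add: kronecker_def mult.assoc)
qed

lemma mat_adjoint_kronecker: "mat_adjoint (kronecker A B) = kronecker (mat_adjoint A) (mat_adjoint B)"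
proof (rule eq_matI)
  fix x y assume "x < dim_row (kronecker (mat_adjoint A) (mat_adjoint B))"
    "y < dim_col (kronecker (mat_adjoint A) (mat_adjoint B))"
  then have x: "x < dim_col A * dim_col B" and y: "y < dim_row A * dim_row B"
    by (simp_all add: kronecker_def)
  have aux: "x div b < a \<and> x mod b < b" if "x < a * b" for x a b :: nat
    using that by (cases "b = 0") (auto simp: less_mult_imp_div_less)
  show "mat_adjoint (kronecker A B) $$ (x, y) = kronecker (mat_adjoint A) (mat_adjoint B) $$ (x, y)"
    using x y aux[OF x] aux[OF y] by (simp add: kronecker_def)
qed (simp_all add: kronecker_def)

text \<open>The entry \<open>(i, j)\<close> is the trace over the second factor of \<open>(1 \<otimes> C) X\<close>. By cyclicity of that
  partial trace, this matrix commutes with \<open>A\<close> as soon as \<open>X\<close> commutes with \<open>A \<otimes> C\<close>.\<close>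

definition weighted_partial_trace :: "nat \<Rightarrow> nat \<Rightarrow> complex mat \<Rightarrow> complex mat \<Rightarrow> complex mat" where
  "weighted_partial_trace n k C X =
     mat n n (\<lambda>(i, j). \<Sum>p<k. \<Sum>r<k. C $$ (p, r) * X $$ (i * k + r, j * k + p))"

lemma weighted_partial_trace_carrier [simp]: "weighted_partial_trace n k C X \<in> carrier_mat n n"
  by (simp add: weighted_partial_trace_def)

text \<open>An expectation value in the composite becomes one on the first factor, where
  \<open>trace_eq_of_time_average\<close> can compare two states.\<close>

lemma trace_kronecker_mult:
  assumes A: "A \<in> carrier_mat n n" and C: "C \<in> carrier_mat k k" and X: "X \<in> carrier_mat (n * k) (n * k)"
  shows "trace_mat (kronecker A C * X) = trace_mat (A * weighted_partial_trace n k C X)"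
proof -
  have K: "kronecker A C \<in> carrier_mat (n * k) (n * k)" using A C by simp
  have "trace_mat (kronecker A C * X) = (\<Sum>a<n * k. \<Sum>b<n * k. kronecker A C $$ (a, b) * X $$ (b, a))"
    using X K carrier_matD(1)[OF K] by (simp add: trace_mat_def index_mult_mat_sum[OF K X] del: index_mult_mat(1))
  also have "\<dots> = (\<Sum>i<n. \<Sum>p<k. \<Sum>j<n. \<Sum>r<k. A $$ (i, j) * (C $$ (p, r) * X $$ (j * k + r, i * k + p)))"
    unfolding sum_lessThan_mult by (intro sum.cong refl) (simp add: kronecker_index_pair[OF A C])
  also have "\<dots> = (\<Sum>i<n. \<Sum>j<n. A $$ (i, j) * (\<Sum>p<k. \<Sum>r<k. C $$ (p, r) * X $$ (j * k + r, i * k + p)))"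
    unfolding sum_distrib_left by (intro sum.cong refl sum.swap)
  also have "\<dots> = trace_mat (A * weighted_partial_trace n k C X)"
    using carrier_matD(1)[OF A]
    by (simp add: trace_mat_def index_mult_mat_sum[OF A weighted_partial_trace_carrier] del: index_mult_mat(1))
       (simp add: weighted_partial_trace_def)
  finally show ?thesis .
qed

lemma weighted_partial_trace_commute:
  assumes A: "A \<in> carrier_mat n n" and C: "C \<in> carrier_mat k k" and X: "X \<in> carrier_mat (n * k) (n * k)"
    and comm: "kronecker A C * X = X * kronecker A C"
  shows "A * weighted_partial_trace n k C X = weighted_partial_trace n k C X * A" (is "A * ?Y = _")
proof (rule eq_matI)
  have K: "kronecker A C \<in> carrier_mat (n * k) (n * k)" using A C by simp
  fix i j assume "i < dim_row (?Y * A)" "j < dim_col (?Y * A)"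
  then have ij: "i < n" "j < n" using A by (auto simp: weighted_partial_trace_def)
  have "(A * ?Y) $$ (i, j) = (\<Sum>l<n. \<Sum>p<k. \<Sum>r<k. A $$ (i, l) * C $$ (p, r) * X $$ (l * k + r, j * k + p))"
    using ij by (simp add: index_mult_mat_sum[OF A weighted_partial_trace_carrier] del: index_mult_mat(1))
      (simp add: weighted_partial_trace_def sum_distrib_left mult.assoc)
  also have "\<dots> = (\<Sum>p<k. \<Sum>l<n. \<Sum>r<k. A $$ (i, l) * C $$ (p, r) * X $$ (l * k + r, j * k + p))"
    by (rule sum.swap)
  \<comment> \<open>For fixed \<open>i\<close>, \<open>j\<close> this is the partial trace of
    \<open>(A \<otimes> C) X\<close>, the form in which \<open>comm\<close> applies. After
    commuting, the traced index is called \<open>r\<close>, so that \<open>C $$ (p, r)\<close>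
    appears as in \<open>weighted_partial_trace\<close>.\<close>
  also have "\<dots> = (\<Sum>p<k. (kronecker A C * X) $$ (i * k + p, j * k + p))"
    using ij by (intro sum.cong refl)
      (simp add: index_mult_mat_sum[OF K X] pair_index_less sum_lessThan_mult kronecker_index_pair[OF A C] del: index_mult_mat(1))
  also have "\<dots> = (\<Sum>p<k. (X * kronecker A C) $$ (i * k + p, j * k + p))" by (simp only: comm)
  also have "\<dots> = (\<Sum>r<k. \<Sum>l<n. \<Sum>p<k. X $$ (i * k + r, l * k + p) * (A $$ (l, j) * C $$ (p, r)))"
    using ij by (intro sum.cong refl)
      (simp add: index_mult_mat_sum[OF X K] pair_index_less sum_lessThan_mult kronecker_index_pair[OF A C] del: index_mult_mat(1))
  also have "\<dots> = (\<Sum>l<n. \<Sum>r<k. \<Sum>p<k. X $$ (i * k + r, l * k + p) * (A $$ (l, j) * C $$ (p, r)))"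
    by (rule sum.swap)
  also have "\<dots> = (\<Sum>l<n. \<Sum>p<k. \<Sum>r<k. X $$ (i * k + r, l * k + p) * (A $$ (l, j) * C $$ (p, r)))"
    by (rule sum.cong[OF refl], rule sum.swap)
  also have "\<dots> = (?Y * A) $$ (i, j)"
    using ij by (simp add: index_mult_mat_sum[OF weighted_partial_trace_carrier A] del: index_mult_mat(1))
      (simp add: weighted_partial_trace_def sum_distrib_left mult_ac)
  finally show "(A * ?Y) $$ (i, j) = (?Y * A) $$ (i, j)" .
qed (use A in \<open>auto simp: weighted_partial_trace_def\<close>)

lemma (in diagonalized) trace_kronecker_eq:
  assumes B: "B \<in> carrier_mat n n" and avg: "time_average A B = A"
    and C: "C \<in> carrier_mat k k" and X: "X \<in> carrier_mat (n * k) (n * k)"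
    and comm: "kronecker A C * X = X * kronecker A C"
  shows "trace_mat (kronecker B C * X) = trace_mat (kronecker A C * X)"
  unfolding trace_kronecker_mult[OF B C X] trace_kronecker_mult[OF A_carrier C X]
  by (rule trace_eq_of_time_average[OF B avg weighted_partial_trace_carrier
        weighted_partial_trace_commute[OF A_carrier C X comm]])

section \<open>The upper occupation as an observable, and absence of cooling\<close>

text \<open>This is the observable 1 \<otimes> |1><1|: with the qubit as last factor, the parity of
  a basis index is the level of the qubit.\<close>

definition upper_level :: "nat \<Rightarrow> complex mat" where
  "upper_level m = mat_diag m (\<lambda>i. if odd i then 1 else 0)"

lemma upper_level_carrier [simp]: "upper_level m \<in> carrier_mat m m"
  by (simp add: upper_level_def)

lemma upper_occupation_reduced:
  assumes S: "S \<in> carrier_mat (m * 2) (m * 2)"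
  shows "upper_occupation (reduced_last 2 S) = Re (trace_mat (S * upper_level (m * 2)))"
proof -
  have "trace_mat (S * upper_level (m * 2)) = (\<Sum>a<m * 2. if odd a then S $$ (a, a) else 0)"
    using S by (simp add: trace_mat_def upper_level_def mat_diag_mult_right[OF S] del: index_mult_mat(1)
        cong: if_cong) (intro sum.cong, auto)
  also have "\<dots> = (\<Sum>k<m. S $$ (k * 2 + 1, k * 2 + 1))"
  proof -
    have "sum g {..<2} = g 0 + g 1" for g :: "nat \<Rightarrow> complex" by (simp add: numeral_2_eq_2)
    then show ?thesis unfolding sum_lessThan_mult by simp
  qed
  also have "\<dots> = reduced_last 2 S $$ (1, 1)"
    using carrier_matD(1)[OF S] by (simp add: reduced_last_def)
  finally show ?thesis by (simp add: upper_occupation_def)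
qed

text \<open>A diagonal qubit state does not connect its two levels, so every entry of the product
  between indices of different parity is zero. The observable is therefore invariant under the
  equilibrium state of the composite.\<close>

lemma kronecker_diag_qubit_commute:
  assumes A: "A \<in> carrier_mat m m"
  shows "kronecker A (mat_diag 2 f) * upper_level (m * 2) = upper_level (m * 2) * kronecker A (mat_diag 2 f)"
proof -
  have K: "kronecker A (mat_diag 2 f) \<in> carrier_mat (m * 2) (m * 2)" using A by simp
  have entry: "kronecker A (mat_diag 2 f) $$ (i, j) =
      (if even i = even j then A $$ (i div 2, j div 2) * f (j mod 2) else 0)"
    if "i < m * 2" "j < m * 2" for i j
  proof -
    have "i mod 2 = j mod 2 \<longleftrightarrow> even i = even j" by presburger
    then show ?thesis using that
      by (simp add: kronecker_index[OF A mat_diag_dim]) (simp add: mat_diag_def)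
  qed
  show ?thesis unfolding upper_level_def mat_diag_mult_left[OF K] mat_diag_mult_right[OF K]
    by (intro eq_matI) (auto simp: entry)
qed

text \<open>Heisenberg picture: the unitary is moved from the state to the observable, so that the
  state remains a product.\<close>

lemma upper_occupation_transform:
  assumes R: "R \<in> carrier_mat (m * 2) (m * 2)" and u: "u \<in> carrier_mat (m * 2) (m * 2)"
  shows "upper_occupation (reduced_last 2 (transform_state u R)) =
    Re (trace_mat (R * (mat_adjoint u * upper_level (m * 2) * u)))"
proof -
  let ?N = "m * 2" and ?M = "upper_level (m * 2)"
  have u': "mat_adjoint u \<in> carrier_mat ?N ?N" using u by simp
  note mc = mult_carrier_mat[of _ ?N ?N _ ?N]
  have "trace_mat (transform_state u R * ?M) = trace_mat (u * (R * (mat_adjoint u * ?M)))"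
    using R u u' unfolding transform_state_def
    by (simp add: assoc_mult_mat[of _ ?N ?N _ ?N _ ?N] mc)
  also have "\<dots> = trace_mat (R * (mat_adjoint u * ?M) * u)"
    using R u u' by (intro trace_mat_mult_comm[of _ ?N ?N]) (simp_all add: mc)
  also have "R * (mat_adjoint u * ?M) * u = R * (mat_adjoint u * ?M * u)"
    using R u u' by (intro assoc_mult_mat[of _ ?N ?N _ ?N _ ?N]) (simp_all add: mc)
  finally have "trace_mat (transform_state u R * ?M) = trace_mat (R * (mat_adjoint u * ?M * u))" .
  moreover have "transform_state u R \<in> carrier_mat ?N ?N" using R u u' by (simp add: transform_state_def mc)
  ultimately show ?thesis by (simp only: upper_occupation_reduced)
qed

theorem (in diagonalized) not_usable_if_time_average_eq:
  assumes B: "B \<in> carrier_mat n n" and avg: "time_average A B = A"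
  shows "\<not> usable_for_cooling (B, A) (mat_diag 2 f, mat_diag 2 f)"
proof
  let ?Q = "(mat_diag 2 f, mat_diag 2 f)"
  assume "usable_for_cooling (B, A) ?Q"
  then obtain Oe u where Oe: "equilibrium_object Oe"
    and allowed: "allowed_unitary ((B, A) \<times>\<^sub>o Oe \<times>\<^sub>o ?Q) u"
    and less: "upper_occupation (reduced_last 2 (transform_state u (fst ((B, A) \<times>\<^sub>o Oe \<times>\<^sub>o ?Q))))
       < upper_occupation (reduced_last 2 (fst ((B, A) \<times>\<^sub>o Oe \<times>\<^sub>o ?Q)))"
    unfolding usable_for_cooling_def by blast
  obtain g where g: "Oe = (g, g)" using Oe by (cases Oe) (auto simp: equilibrium_object_def)
  define m where "m = dim_row g"
  have gc: "g \<in> carrier_mat m m"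
    using Oe by (auto simp: g m_def equilibrium_object_def is_object_def full_rank_def)
  define C where "C = kronecker g (mat_diag 2 f)"
  let ?k = "m * 2" and ?N = "n * m * 2"
  have N: "n * ?k = ?N" by simp
  have C: "C \<in> carrier_mat ?k ?k" using gc by (simp add: C_def)
  define G where "G = kronecker A C"
  define R where "R = kronecker B C"
  have G: "G \<in> carrier_mat ?N ?N" and R: "R \<in> carrier_mat ?N ?N"
    using kronecker_carrier[OF A_carrier C] kronecker_carrier[OF B C] by (simp_all add: G_def R_def N)
  have comp: "(B, A) \<times>\<^sub>o Oe \<times>\<^sub>o ?Q = (R, G)"
    by (simp add: compose_obj_def g kronecker_assoc R_def G_def C_def)
  let ?M = "upper_level ?N"
  have u: "u \<in> carrier_mat ?N ?N" and uu: "mat_adjoint u * u = 1\<^sub>m ?N" "u * mat_adjoint u = 1\<^sub>m ?N"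
    and uG: "u * G = G * u"
    using allowed G unfolding comp allowed_unitary_def unitary_mat_def by auto
  have u': "mat_adjoint u \<in> carrier_mat ?N ?N" using u by simp
  note mc = mult_carrier_mat[of _ ?N ?N _ ?N] and asc = assoc_mult_mat[of _ ?N ?N _ ?N _ ?N]
  have GM: "G * ?M = ?M * G"
    using kronecker_diag_qubit_commute[OF kronecker_carrier[OF A_carrier gc], of f]
    by (simp add: G_def C_def kronecker_assoc)
  have u'G: "mat_adjoint u * G = G * mat_adjoint u"
  proof -
    have "mat_adjoint u * G = mat_adjoint u * G * (u * mat_adjoint u)" using u' G by (simp add: uu mc)
    also have "\<dots> = mat_adjoint u * (G * u) * mat_adjoint u" using u u' G by (simp add: mc asc)
    also have "\<dots> = (mat_adjoint u * u) * G * mat_adjoint u" unfolding uG[symmetric] using u u' G by (simp add: mc asc)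
    also have "\<dots> = G * mat_adjoint u" using u' G by (simp add: uu mc)
    finally show ?thesis .
  qed
  define X where "X = mat_adjoint u * ?M * u"
  have X: "X \<in> carrier_mat ?N ?N" using u u' by (simp add: X_def mc)
  have "G * X = (G * mat_adjoint u) * ?M * u" using G u u' by (simp add: X_def mc asc)
  also have "\<dots> = mat_adjoint u * (G * ?M) * u" unfolding u'G[symmetric] using G u u' by (simp add: mc asc)
  also have "\<dots> = mat_adjoint u * ?M * (G * u)" unfolding GM using G u u' by (simp add: mc asc)
  also have "\<dots> = X * G" unfolding uG[symmetric] using G u u' by (simp add: X_def mc asc)
  finally have GX: "G * X = X * G" .
  \<comment> \<open>This applies both to \<open>X\<close>, the observable after the transformation,
    and to \<open>?M\<close>, the observable before it, as each commutes with
    \<open>G\<close>.\<close>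
  have red: "trace_mat (R * Z) = trace_mat (G * Z)" if "Z \<in> carrier_mat ?N ?N" "G * Z = Z * G" for Z
    unfolding R_def G_def using that by (intro trace_kronecker_eq[OF B avg C]) (simp_all add: N G_def)
  \<comment> \<open>\<open>R\<close> is replaced by \<open>G\<close>, the unitary cancels because
    \<open>G\<close> is invariant under it, and \<open>G\<close> is replaced by \<open>R\<close>
    again.\<close>
  have "trace_mat (R * X) = trace_mat (G * X)" using red X GX by simp
  also have "\<dots> = trace_mat (mat_adjoint u * (?M * (u * G)))"
    unfolding GX using G u u' by (simp add: X_def mc asc)
  also have "\<dots> = trace_mat (?M * (u * G) * mat_adjoint u)"
    using G u u' by (intro trace_mat_mult_comm[of _ ?N ?N]) (simp_all add: mc)
  also have "\<dots> = trace_mat (?M * G * (u * mat_adjoint u))" unfolding uG using G u u' by (simp add: mc asc)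
  also have "\<dots> = trace_mat (G * ?M)" using G by (simp add: uu mc GM)
  also have "\<dots> = trace_mat (R * ?M)" using red[OF upper_level_carrier GM] by simp
  finally have "upper_occupation (reduced_last 2 (transform_state u R)) = upper_occupation (reduced_last 2 R)"
    unfolding upper_occupation_transform[OF R u] upper_occupation_reduced[OF R] X_def by simp
  with less show False by (simp add: comp)
qed

subsection \<open>Exchanging two vectors of equal energy\<close>

definition rank_one :: "complex vec \<Rightarrow> complex mat" where
  "rank_one x = mat (dim_vec x) (dim_vec x) (\<lambda>(i, j). x $ i * cnj (x $ j))"

lemma rank_one_carrier [simp]: "x \<in> carrier_vec n \<Longrightarrow> rank_one x \<in> carrier_mat n n"
  by (simp add: rank_one_def)

lemma rank_one_mult_vec:
  assumes x: "x \<in> carrier_vec n" and v: "v \<in> carrier_vec n"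
  shows "rank_one x *\<^sub>v v = (v \<bullet>c x) \<cdot>\<^sub>v x"
proof (rule eq_vecI)
  fix i assume "i < dim_vec ((v \<bullet>c x) \<cdot>\<^sub>v x)"
  with x have i: "i < n" by simp
  have "(rank_one x *\<^sub>v v) $ i = (\<Sum>l<n. x $ i * (v $ l * cnj (x $ l)))"
    using x i by (subst index_mult_mat_vec_sum[OF rank_one_carrier[OF x] v]) (auto simp: rank_one_def mult_ac intro!: sum.cong)
  then show "(rank_one x *\<^sub>v v) $ i = ((v \<bullet>c x) \<cdot>\<^sub>v x) $ i"
    using x i by (simp add: cscalar_prod_sum[OF x] sum_distrib_left mult.commute)
qed (use x in \<open>simp add: rank_one_def\<close>)

lemma trace_mult_rank_one:
  assumes R: "R \<in> carrier_mat n n" and x: "x \<in> carrier_vec n"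
  shows "trace_mat (R * rank_one x) = (R *\<^sub>v x) \<bullet>c x"
proof -
  have "trace_mat (R * rank_one x) = (\<Sum>i<n. \<Sum>l<n. R $$ (i, l) * (x $ l * cnj (x $ i)))"
    using R x by (simp add: trace_mat_def index_mult_mat_sum[OF R rank_one_carrier[OF x]] del: index_mult_mat(1))
      (simp add: rank_one_def)
  also have "\<dots> = (R *\<^sub>v x) \<bullet>c x"
    by (simp add: cscalar_prod_sum[OF x] index_mult_mat_vec_sum[OF R x] sum_distrib_right mult.assoc del: index_mult_mat_vec)
  finally show ?thesis .
qed

text \<open>A Hermitian \<open>G\<close> with eigenvector \<open>z\<close> preserves the line of
  \<open>z\<close> and its orthogonal complement, and the reflection is a scalar on each. It makes
  the exchange allowed: the difference of two vectors of equal energy is again an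
  eigenvector.\<close>

lemma householder_commute:
  assumes G: "G \<in> carrier_mat n n" and z: "z \<in> carrier_vec n" and herm: "mat_adjoint G = G"
    and eig: "G *\<^sub>v z = complex_of_real g \<cdot>\<^sub>v z"
  shows "householder z * G = G * householder z"
proof (rule mat_eqI_mult_vec[of _ n n])
  fix v :: "complex vec" assume v: "v \<in> carrier_vec n"
  have Gv: "G *\<^sub>v v \<in> carrier_vec n" by (rule mult_mat_vec_carrier[OF G v])
  have "(G *\<^sub>v v) \<bullet>c z = v \<bullet>c (G *\<^sub>v z)" using cscalar_prod_mat_adjoint[OF G v z] herm by simp
  also have "\<dots> = complex_of_real g * (v \<bullet>c z)" using v z by (simp add: eig conjugate_smult_vec)
  finally have ip: "(G *\<^sub>v v) \<bullet>c z = complex_of_real g * (v \<bullet>c z)" .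
  have "(householder z * G) *\<^sub>v v = G *\<^sub>v v - (2 / (z \<bullet>c z) * (complex_of_real g * (v \<bullet>c z))) \<cdot>\<^sub>v z"
    by (simp only: assoc_mult_mat_vec[OF householder_carrier[OF z] G v] householder_mult_vec[OF z Gv] ip)
  also have "\<dots> = G *\<^sub>v v - (2 / (z \<bullet>c z) * (v \<bullet>c z)) \<cdot>\<^sub>v (G *\<^sub>v z)"
    by (simp add: eig smult_smult_assoc mult_ac)
  also have "\<dots> = G *\<^sub>v (v - (2 / (z \<bullet>c z) * (v \<bullet>c z)) \<cdot>\<^sub>v z)"
    using G v z by (simp add: mult_minus_distrib_mat_vec[of G n n] mult_mat_vec[of G n n])
  also have "\<dots> = (G * householder z) *\<^sub>v v"
    by (simp only: assoc_mult_mat_vec[OF G householder_carrier[OF z] v] householder_mult_vec[OF z v])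
  finally show "(householder z * G) *\<^sub>v v = (G * householder z) *\<^sub>v v" .
qed (use G z householder_carrier[OF z] in \<open>simp_all add: mult_carrier_mat[of _ n n]\<close>)

text \<open>For orthonormal \<open>x\<close>, \<open>y\<close> the reflection along \<open>x - y\<close> exchanges \<open>x\<close> and \<open>y\<close>.\<close>

lemma householder_conj_exchange:
  assumes M: "M \<in> carrier_mat n n" and x: "x \<in> carrier_vec n" and y: "y \<in> carrier_vec n"
    and Madj: "mat_adjoint M = M"
    and Mx: "M *\<^sub>v x = x" and My: "M *\<^sub>v y = 0\<^sub>v n"
    and xx: "x \<bullet>c x = 1" and yy: "y \<bullet>c y = 1" and xy: "x \<bullet>c y = 0"
  shows "householder (x - y) * M * householder (x - y) = M - rank_one x + rank_one y"
proof (rule mat_eqI_mult_vec[of _ n n])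
  let ?z = "x - y" and ?H = "householder (x - y)"
  have z: "?z \<in> carrier_vec n" using x y by simp
  have H: "?H \<in> carrier_mat n n" using z by simp
  show "?H * M * ?H \<in> carrier_mat n n" "M - rank_one x + rank_one y \<in> carrier_mat n n"
    using M H x y by (simp_all add: mult_carrier_mat[of _ n n])
  have yx: "y \<bullet>c x = 0"
  proof -
    have "y \<bullet>c x = cnj (x \<bullet>c y)" using x y by (simp add: cscalar_prod_sum[of _ n] mult.commute)
    then show ?thesis by (simp add: xy)
  qed
  have sub: "v \<bullet>c ?z = v \<bullet>c x - v \<bullet>c y" if "v \<in> carrier_vec n" for v
    using that x y by (simp add: cscalar_prod_sum[of _ n] sum_subtractf algebra_simps)
  have "?z \<bullet>c ?z = ?z \<bullet>c x - ?z \<bullet>c y" by (rule sub[OF z])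
  also have "\<dots> = 2" using x y xx yy xy yx by (simp add: minus_scalar_prod_distrib[of _ n])
  finally have zz: "?z \<bullet>c ?z = 2" .
  have Hv: "?H *\<^sub>v v = v - (v \<bullet>c ?z) \<cdot>\<^sub>v ?z" if "v \<in> carrier_vec n" for v
    by (simp add: householder_mult_vec[OF z that] zz)
  have Mz: "M *\<^sub>v ?z = x" using M x y by (simp add: mult_minus_distrib_mat_vec[of M n n] Mx My)
  fix v :: "complex vec" assume v: "v \<in> carrier_vec n"
  define a b where "a = v \<bullet>c x" and "b = v \<bullet>c y"
  have Mv: "M *\<^sub>v v \<in> carrier_vec n" by (rule mult_mat_vec_carrier[OF M v])
  \<comment> \<open>\<open>M\<close> is moved to the other side of the product, where it maps
    \<open>x - y\<close> to \<open>x\<close>.\<close>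
  have Mvz: "(M *\<^sub>v v) \<bullet>c ?z = a"
    using cscalar_prod_mat_adjoint[OF M v z] by (simp add: Madj Mz a_def)
  have w: "M *\<^sub>v v - (a - b) \<cdot>\<^sub>v x \<in> carrier_vec n" using Mv x by simp
  have xz: "x \<bullet>c ?z = 1" using sub[OF x] xx xy by simp
  have wz: "(M *\<^sub>v v - (a - b) \<cdot>\<^sub>v x) \<bullet>c ?z = b"
    using Mv x z by (simp add: minus_scalar_prod_distrib[of _ n] Mvz xz)
  have "(?H * M * ?H) *\<^sub>v v = ?H *\<^sub>v (M *\<^sub>v (?H *\<^sub>v v))"
    using M H v by (simp add: assoc_mult_mat_vec[of _ n n _ n] mult_carrier_mat[of _ n n] mult_mat_vec_carrier[of _ n n])
  also have "?H *\<^sub>v v = v - (a - b) \<cdot>\<^sub>v ?z" by (simp add: Hv[OF v] sub[OF v] a_def b_def)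
  also have "M *\<^sub>v (v - (a - b) \<cdot>\<^sub>v ?z) = M *\<^sub>v v - (a - b) \<cdot>\<^sub>v x"
    using M v z by (simp add: mult_minus_distrib_mat_vec[of M n n] mult_mat_vec[of M n n] Mz)
  also have "?H *\<^sub>v (M *\<^sub>v v - (a - b) \<cdot>\<^sub>v x) = M *\<^sub>v v - (a - b) \<cdot>\<^sub>v x - b \<cdot>\<^sub>v ?z"
    by (simp add: Hv[OF w] wz)
  also have "\<dots> = M *\<^sub>v v - a \<cdot>\<^sub>v x + b \<cdot>\<^sub>v y"
    using Mv x y by (intro eq_vecI) (auto simp: algebra_simps simp del: index_mult_mat_vec)
  also have "\<dots> = (M - rank_one x + rank_one y) *\<^sub>v v"
  proof -
    have r: "rank_one x \<in> carrier_mat n n" "rank_one y \<in> carrier_mat n n" "M - rank_one x \<in> carrier_mat n n"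
      using M x y by (simp_all add: minus_carrier_mat)
    show ?thesis
      unfolding add_mult_distrib_mat_vec[OF r(3,2) v] minus_mult_distrib_mat_vec[OF M r(1) v]
        rank_one_mult_vec[OF x v] rank_one_mult_vec[OF y v] a_def b_def by (rule refl)
  qed
  finally show "(?H * M * ?H) *\<^sub>v v = (M - rank_one x + rank_one y) *\<^sub>v v" .
qed

section \<open>Product vectors and diagonal states\<close>

text \<open>This is v \<otimes> e_p in C^n \<otimes> C^k, in the index convention of
  \<open>kronecker\<close>.\<close>

definition tensor_unit :: "nat \<Rightarrow> nat \<Rightarrow> complex vec \<Rightarrow> complex vec" where
  "tensor_unit k p v = vec (dim_vec v * k) (\<lambda>a. if a mod k = p then v $ (a div k) else 0)"

lemma tensor_unit_carrier [simp]: "v \<in> carrier_vec n \<Longrightarrow> tensor_unit k p v \<in> carrier_vec (n * k)"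
  by (auto simp: tensor_unit_def)

lemma tensor_unit_index:
  assumes "v \<in> carrier_vec n" "i < n" "r < k"
  shows "tensor_unit k p v $ (i * k + r) = (if r = p then v $ i else 0)"
  using assms by (simp add: tensor_unit_def pair_index_less)

text \<open>Different second factors give orthogonal vectors for all \<open>v\<close> and
  \<open>w\<close>. Hence the two vectors to be exchanged are orthonormal even if the eigenvectors
  behind them are not orthogonal.\<close>

lemma cscalar_prod_tensor_unit:
  assumes "v \<in> carrier_vec n" "w \<in> carrier_vec n" "p < k" "r < k"
  shows "tensor_unit k p v \<bullet>c tensor_unit k r w = (if p = r then v \<bullet>c w else 0)"
proof -
  have "tensor_unit k p v \<bullet>c tensor_unit k r w =
      (\<Sum>i<n. \<Sum>s<k. (if s = p then v $ i else 0) * cnj (if s = r then w $ i else 0))"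
    using assms by (simp add: cscalar_prod_sum[of _ "n * k"] sum_lessThan_mult tensor_unit_index)
  also have "\<dots> = (\<Sum>i<n. \<Sum>s<k. if s = p then (if p = r then v $ i * cnj (w $ i) else 0) else 0)"
    by (intro sum.cong) auto
  also have "\<dots> = (if p = r then v \<bullet>c w else 0)"
    using assms by (simp add: cscalar_prod_sum[of w n])
  finally show ?thesis .
qed

lemma kronecker_diag_tensor_unit:
  assumes A: "A \<in> carrier_mat n n" and v: "v \<in> carrier_vec n" and p: "p < k"
  shows "kronecker A (mat_diag k d) *\<^sub>v tensor_unit k p v = d p \<cdot>\<^sub>v tensor_unit k p (A *\<^sub>v v)"
proof (rule eq_vecI)
  have K: "kronecker A (mat_diag k d) \<in> carrier_mat (n * k) (n * k)" using A by simp
  have Av: "A *\<^sub>v v \<in> carrier_vec n" by (rule mult_mat_vec_carrier[OF A v])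
  show "dim_vec (kronecker A (mat_diag k d) *\<^sub>v tensor_unit k p v) = dim_vec (d p \<cdot>\<^sub>v tensor_unit k p (A *\<^sub>v v))"
    using carrier_matD(1)[OF K] carrier_vecD[OF tensor_unit_carrier[OF Av, of k p]] by simp
  fix a assume "a < dim_vec (d p \<cdot>\<^sub>v tensor_unit k p (A *\<^sub>v v))"
  then have a: "a < n * k" using carrier_vecD[OF tensor_unit_carrier[OF Av, of k p]] by simp
  define i r where "i = a div k" and "r = a mod k"
  have ir: "i < n" "r < k" "a = i * k + r"
    using a p by (simp_all add: i_def r_def less_mult_imp_div_less)
  have "(kronecker A (mat_diag k d) *\<^sub>v tensor_unit k p v) $ a =
      (\<Sum>j<n. \<Sum>s<k. A $$ (i, j) * mat_diag k d $$ (r, s) * (if s = p then v $ j else 0))"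
    using ir a by (subst index_mult_mat_vec_sum[OF K tensor_unit_carrier[OF v] a])
      (simp add: sum_lessThan_mult kronecker_index_pair[OF A mat_diag_dim] tensor_unit_index[OF v])
  also have "\<dots> = (\<Sum>j<n. \<Sum>s<k. if s = p then A $$ (i, j) * mat_diag k d $$ (r, p) * v $ j else 0)"
    by (intro sum.cong) auto
  also have "\<dots> = (\<Sum>j<n. A $$ (i, j) * mat_diag k d $$ (r, p) * v $ j)" using p by simp
  also have "\<dots> = mat_diag k d $$ (r, p) * (A *\<^sub>v v) $ i"
    by (simp add: index_mult_mat_vec_sum[OF A v ir(1)] sum_distrib_left mult_ac del: index_mult_mat_vec)
  also have "\<dots> = (d p \<cdot>\<^sub>v tensor_unit k p (A *\<^sub>v v)) $ a"
    using a ir p carrier_vecD[OF tensor_unit_carrier[OF Av, of k p]]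
    by (simp add: tensor_unit_index[OF Av] mat_diag_def del: index_mult_mat_vec)
  finally show "(kronecker A (mat_diag k d) *\<^sub>v tensor_unit k p v) $ a = (d p \<cdot>\<^sub>v tensor_unit k p (A *\<^sub>v v)) $ a" .
qed

lemma kronecker_mat_diag:
  "kronecker (mat_diag a f) (mat_diag b g) = mat_diag (a * b) (\<lambda>i. f (i div b) * g (i mod b))"
proof (rule eq_matI)
  fix x y assume "x < dim_row (mat_diag (a * b) (\<lambda>i. f (i div b) * g (i mod b)))"
    "y < dim_col (mat_diag (a * b) (\<lambda>i. f (i div b) * g (i mod b)))"
  then have x: "x < a * b" and y: "y < a * b" by (auto simp: mat_diag_def)
  have aux: "x div b < a" "x mod b < b" if "x < a * b" for x
    using that by (cases "b = 0"; auto simp: less_mult_imp_div_less)+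
  have "x div b = y div b \<Longrightarrow> x mod b = y mod b \<Longrightarrow> x = y" by (metis div_mult_mod_eq)
  then show "kronecker (mat_diag a f) (mat_diag b g) $$ (x, y) =
      mat_diag (a * b) (\<lambda>i. f (i div b) * g (i mod b)) $$ (x, y)"
    using x y aux[OF x] aux[OF y]
    by (subst kronecker_index[OF mat_diag_dim mat_diag_dim x y]) (auto simp: mat_diag_def)
qed (auto simp: kronecker_def mat_diag_def)

text \<open>C^4 holds the ancilla and the target qubit, with \<open>p\<close> equal to twice the
  ancilla level plus the target level. So \<open>p\<close> is odd exactly when the target is in its
  upper level.\<close>

lemma upper_level_tensor_unit:
  assumes v: "v \<in> carrier_vec n" and p: "p < 4"
  shows "upper_level (n * 4) *\<^sub>v tensor_unit 4 p v = (if odd p then tensor_unit 4 p v else 0\<^sub>v (n * 4))"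
proof (rule eq_vecI)
  show "dim_vec (upper_level (n * 4) *\<^sub>v tensor_unit 4 p v) =
      dim_vec (if odd p then tensor_unit 4 p v else 0\<^sub>v (n * 4))"
    using v by (simp add: upper_level_def mat_diag_def tensor_unit_def)
  fix a assume "a < dim_vec (if odd p then tensor_unit 4 p v else 0\<^sub>v (n * 4))"
  then have a: "a < n * 4" using v by (auto simp: tensor_unit_def split: if_splits)
  have "odd (a mod 4) \<longleftrightarrow> odd a" by presburger
  then show "(upper_level (n * 4) *\<^sub>v tensor_unit 4 p v) $ a =
      (if odd p then tensor_unit 4 p v else 0\<^sub>v (n * 4)) $ a"
    using a v unfolding upper_level_def
    by (subst mat_diag_mult_vec[OF tensor_unit_carrier[OF v] a]) (auto simp: tensor_unit_def)
qed

lemma cscalar_prod_mat_diag: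
  assumes "v \<in> carrier_vec n"
  shows "(mat_diag n f *\<^sub>v v) \<bullet>c v = (\<Sum>i<n. f i * (v $ i * cnj (v $ i)))"
  using assms by (simp add: cscalar_prod_sum[of v n] mat_diag_mult_vec[OF assms] mult.assoc del: index_mult_mat_vec)

lemma det_mat_diag: "det (mat_diag n f) = (\<Prod>i<n. f i)"
proof -
  have "upper_triangular (mat_diag n f)" by (auto simp: mat_diag_def)
  then have "det (mat_diag n f) = prod_list (diag_mat (mat_diag n f))"
    by (rule det_upper_triangular) (rule mat_diag_dim)
  also have "diag_mat (mat_diag n f) = map f [0..<n]"
    by (auto simp: diag_mat_def mat_diag_def intro!: nth_equalityI)
  also have "prod_list (map f [0..<n]) = (\<Prod>i<n. f i)"
    by (simp add: prod.distinct_set_conv_list[symmetric] atLeast0LessThan)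
  finally show ?thesis .
qed

lemma equilibrium_object_mat_diag:
  fixes e :: "nat \<Rightarrow> real"
  assumes pos: "\<And>i. i < n \<Longrightarrow> e i > 0" and sum1: "(\<Sum>i<n. e i) = 1"
  defines "g \<equiv> mat_diag n (\<lambda>i. complex_of_real (e i))"
  shows "equilibrium_object (g, g)"
proof -
  have g: "g \<in> carrier_mat n n" by (simp add: g_def)
  have dim: "dim_row g = n" "dim_col g = n" using g by auto
  have herm: "hermitian_mat g" using dim by (simp add: hermitian_mat_def) (simp add: g_def mat_adjoint_mat_diag)
  have "psd_mat g"
    unfolding psd_mat_def dim
  proof (intro conjI ballI herm)
    fix v :: "complex vec" assume v: "v \<in> carrier_vec n"
    have "(g *\<^sub>v v) \<bullet>c v = complex_of_real (\<Sum>i<n. e i * (cmod (v $ i))\<^sup>2)"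
      by (simp only: g_def cscalar_prod_mat_diag[OF v] of_real_sum of_real_mult complex_norm_square)
    moreover have "(\<Sum>i<n. e i * (cmod (v $ i))\<^sup>2) \<ge> 0"
      using pos by (intro sum_nonneg) (simp add: less_imp_le)
    ultimately show "0 \<le> Re ((g *\<^sub>v v) \<bullet>c v)" by simp
  qed
  moreover have "trace_mat g = complex_of_real (\<Sum>i<n. e i)"
    unfolding trace_mat_def dim by (simp add: g_def mat_diag_def)
  moreover have "det g \<noteq> 0"
    using pos unfolding g_def det_mat_diag by (auto simp: less_imp_neq[THEN not_sym])
  then have "full_rank g" using vec_space.det_rank_iff[OF g] dim by (simp add: full_rank_def)
  ultimately show ?thesis using sum1 by (simp add: equilibrium_object_def is_object_def density_mat_def)
qed

text \<open>The ancillary qubit is chosen so that \<open>v \<otimes> e\<^sub>0 \<otimes> e\<^sub>1\<close> and \<open>w \<otimes> e\<^sub>1 \<otimes> e\<^sub>0\<close> have the same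
  energy; exchanging these two vectors is then allowed.\<close>

theorem usable_if_eigenvector_ratios_differ:
  fixes s :: "nat \<Rightarrow> real"
  assumes A: "A \<in> carrier_mat n n" "mat_adjoint A = A" and B: "B \<in> carrier_mat n n"
    and s: "s 0 > 0" "s 1 > 0"
    and v: "v \<in> carrier_vec n" "v \<bullet>c v = 1" "A *\<^sub>v v = complex_of_real l \<cdot>\<^sub>v v" "l > 0"
    and w: "w \<in> carrier_vec n" "w \<bullet>c w = 1" "A *\<^sub>v w = complex_of_real m \<cdot>\<^sub>v w" "m > 0"
    and ratio: "Re ((B *\<^sub>v v) \<bullet>c v) / l > Re ((B *\<^sub>v w) \<bullet>c w) / m"
  defines "Q \<equiv> mat_diag 2 (\<lambda>i. complex_of_real (s i))"
  shows "usable_for_cooling (B, A) (Q, Q)"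
proof -
  define N where "N = m * s 0 + l * s 1"
  have N: "N > 0" using s v(4) w(4) by (simp add: N_def add_pos_pos)
  \<comment> \<open>The weights solve \<open>l * (e 0 * s 1) = m * (e 1 * s 0)\<close>, the equality
    of the eigenvalues of the composite equilibrium state on the two vectors; \<open>N\<close>
    normalises the trace.\<close>
  define e where "e i = (if i = 0 then m * s 0 else l * s 1) / N" for i :: nat
  define g where "g = mat_diag 2 (\<lambda>i. complex_of_real (e i))"
  have eq: "equilibrium_object (g, g)"
    unfolding g_def using s v(4) w(4) N
    by (intro equilibrium_object_mat_diag) (auto simp: e_def N_def numeral_2_eq_2 add_divide_distrib[symmetric])
  define d where "d i = e (i div 2) * s (i mod 2)" for i
  define C where "C = mat_diag 4 (\<lambda>i. complex_of_real (d i))"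
  have C: "kronecker g Q = C"
    by (simp add: g_def Q_def C_def kronecker_mat_diag d_def)
  define G where "G = kronecker A C"
  define R where "R = kronecker B C"
  have comp: "(B, A) \<times>\<^sub>o (g, g) \<times>\<^sub>o (Q, Q) = (R, G)"
    by (simp add: compose_obj_def kronecker_assoc R_def G_def C)
  have Cc: "C \<in> carrier_mat 4 4" by (simp add: C_def)
  have G: "G \<in> carrier_mat (n * 4) (n * 4)" and R: "R \<in> carrier_mat (n * 4) (n * 4)"
    using kronecker_carrier[OF A(1) Cc] kronecker_carrier[OF B Cc] by (simp_all add: G_def R_def)
  have "mat_adjoint C = C" by (simp add: C_def mat_adjoint_mat_diag)
  then have Gadj: "mat_adjoint G = G" by (simp add: G_def mat_adjoint_kronecker A(2))
  \<comment> \<open>Index 1 is ancilla down and target up, index 2 is ancilla up and target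
    down.\<close>
  define x where "x = tensor_unit 4 1 v"
  define y where "y = tensor_unit 4 2 w"
  have x: "x \<in> carrier_vec (n * 4)" and y: "y \<in> carrier_vec (n * 4)"
    using tensor_unit_carrier[OF v(1), of 4] tensor_unit_carrier[OF w(1), of 4] by (simp_all add: x_def y_def)
  have z: "x - y \<in> carrier_vec (n * 4)" using x y by simp
  have prods: "x \<bullet>c x = 1" "y \<bullet>c y = 1" "x \<bullet>c y = 0"
    using v w by (simp_all add: x_def y_def cscalar_prod_tensor_unit[of _ n])
  have d: "d 1 = e 0 * s 1" "d 2 = e 1 * s 0" by (simp_all add: d_def)
  have dpos: "l * d 1 > 0" unfolding d e_def using s v(4) w(4) N by simp
  have energy: "l * d 1 = m * d 2" unfolding d e_def by simp
  have tensor_smult: "tensor_unit k p (c \<cdot>\<^sub>v t) = c \<cdot>\<^sub>v tensor_unit k p t" for k p c t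
    by (intro eq_vecI) (auto simp: tensor_unit_def less_mult_imp_div_less)
  have Gx: "G *\<^sub>v x = complex_of_real (l * d 1) \<cdot>\<^sub>v x"
    by (simp add: G_def C_def x_def kronecker_diag_tensor_unit[OF A(1) v(1)] v(3) tensor_smult smult_smult_assoc mult.commute)
  have Gy: "G *\<^sub>v y = complex_of_real (l * d 1) \<cdot>\<^sub>v y"
    unfolding energy
    by (simp add: G_def C_def y_def kronecker_diag_tensor_unit[OF A(1) w(1)] w(3) tensor_smult smult_smult_assoc mult.commute)
  have smult_minus: "c \<cdot>\<^sub>v (x - y) = c \<cdot>\<^sub>v x - c \<cdot>\<^sub>v y" for c
    using x y by (intro eq_vecI) (auto simp: algebra_simps)
  have "G *\<^sub>v (x - y) = complex_of_real (l * d 1) \<cdot>\<^sub>v (x - y)"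
    unfolding mult_minus_distrib_mat_vec[OF G x y] Gx Gy smult_minus by (rule refl)
  then have comm: "householder (x - y) * G = G * householder (x - y)"
    by (rule householder_commute[OF G z Gadj])
  let ?u = "householder (x - y)"
  have u: "?u \<in> carrier_mat (n * 4) (n * 4)" using z by simp
  have allowed: "allowed_unitary (R, G) ?u"
    using comm unitary_householder carrier_matD[OF u] carrier_matD[OF G] by (simp add: allowed_unitary_def)
  let ?M = "upper_level (n * 4)"
  have Mx: "?M *\<^sub>v x = x" using upper_level_tensor_unit[OF v(1), of 1] by (simp add: x_def)
  have My: "?M *\<^sub>v y = 0\<^sub>v (n * 4)" using upper_level_tensor_unit[OF w(1), of 2] by (simp add: y_def)
  have Madj: "mat_adjoint ?M = ?M"
    by (simp add: upper_level_def mat_adjoint_mat_diag if_distrib[of cnj] cong: if_cong)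
  have n4: "n * 4 = (n * 2) * 2" by simp
  have R2: "R \<in> carrier_mat (n * 2 * 2) (n * 2 * 2)" and u2: "?u \<in> carrier_mat (n * 2 * 2) (n * 2 * 2)"
    using R u unfolding n4 .
  have Rx: "(R *\<^sub>v x) \<bullet>c x = complex_of_real (d 1) * ((B *\<^sub>v v) \<bullet>c v)"
    using v(1) B by (simp add: R_def C_def x_def kronecker_diag_tensor_unit[OF B] mult_mat_vec_carrier[of _ n n]
      smult_scalar_prod_distrib[of _ "n * 4"] cscalar_prod_tensor_unit[of _ n])
  have Ry: "(R *\<^sub>v y) \<bullet>c y = complex_of_real (d 2) * ((B *\<^sub>v w) \<bullet>c w)"
    using w(1) B by (simp add: R_def C_def y_def kronecker_diag_tensor_unit[OF B] mult_mat_vec_carrier[of _ n n]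
      smult_scalar_prod_distrib[of _ "n * 4"] cscalar_prod_tensor_unit[of _ n])
  have r1: "rank_one x \<in> carrier_mat (n * 4) (n * 4)" "rank_one y \<in> carrier_mat (n * 4) (n * 4)"
    using x y by simp_all
  have trace_add: "trace_mat (S + T) = trace_mat S + trace_mat T"
    if "S \<in> carrier_mat k k" "T \<in> carrier_mat k k" for S T k
    using that by (simp add: trace_mat_def sum.distrib)
  have trace_minus: "trace_mat (S - T) = trace_mat S - trace_mat T"
    if "S \<in> carrier_mat k k" "T \<in> carrier_mat k k" for S T k
    using that by (simp add: trace_mat_def sum_subtractf)
  have "upper_occupation (reduced_last 2 (transform_state ?u R)) = Re (trace_mat (R * (?u * ?M * ?u)))"
    using upper_occupation_transform[OF R2 u2, folded n4] unfolding householder_adjoint .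
  also have "?u * ?M * ?u = ?M - rank_one x + rank_one y"
    by (rule householder_conj_exchange[OF upper_level_carrier x y Madj Mx My prods])
  also have "R * (?M - rank_one x + rank_one y) = R * ?M - R * rank_one x + R * rank_one y"
    unfolding mult_add_distrib_mat[OF R minus_carrier_mat[OF r1(1)] r1(2)]
      mult_minus_distrib_mat[OF R upper_level_carrier r1(1)] by (rule refl)
  also have "trace_mat \<dots> = trace_mat (R * ?M) - (R *\<^sub>v x) \<bullet>c x + (R *\<^sub>v y) \<bullet>c y"
    using R r1 x y by (simp add: trace_add[of _ "n * 4"] trace_minus[of _ "n * 4"] trace_mult_rank_one[of _ "n * 4"]
      mult_carrier_mat[of _ "n * 4" "n * 4"] minus_carrier_mat)
  \<comment> \<open>The exchange empties \<open>x\<close> from the upper level of the target and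
    fills it with the former weight of \<open>y\<close>.\<close>
  also have "Re \<dots> = upper_occupation (reduced_last 2 R) - d 1 * Re ((B *\<^sub>v v) \<bullet>c v) + d 2 * Re ((B *\<^sub>v w) \<bullet>c w)"
    using upper_occupation_reduced[OF R2, folded n4] by (simp add: Rx Ry)
  also have "\<dots> < upper_occupation (reduced_last 2 R)"
  proof -
    \<comment> \<open>Both weights are written as the common eigenvalue \<open>l * d 1\<close> times
      a ratio, which reduces the claim to \<open>ratio\<close>.\<close>
    have "d 2 * Re ((B *\<^sub>v w) \<bullet>c w) = (l * d 1) * (Re ((B *\<^sub>v w) \<bullet>c w) / m)"
      unfolding energy using w(4) by simp
    also have "\<dots> < (l * d 1) * (Re ((B *\<^sub>v v) \<bullet>c v) / l)"
      using ratio dpos by (rule mult_strict_left_mono)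
    also have "\<dots> = d 1 * Re ((B *\<^sub>v v) \<bullet>c v)" using v(4) by simp
    finally show ?thesis by simp
  qed
  finally show ?thesis
    unfolding usable_for_cooling_def using eq allowed comp by (metis fst_conv)
qed

subsection \<open>Equality on eigenspaces\<close>

lemma mult_unit_vec_form:
  fixes B :: "complex mat"
  assumes "B \<in> carrier_mat n n" "i < n"
  shows "(B *\<^sub>v unit_vec n i) \<bullet>c unit_vec n i = B $$ (i, i)"
proof -
  have u: "unit_vec n i $ k = (if k = i then 1 else 0 :: complex)" if "k < n" for k
    using that assms by simp
  have "(B *\<^sub>v unit_vec n i) \<bullet>c unit_vec n i = (\<Sum>k<n. if k = i then B $$ (i, i) else 0)"
    using assms by (simp add: cscalar_prod_sum[of _ n] u if_distrib[of cnj] if_distrib[of "\<lambda>t. _ * t"] cong: if_cong)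
  then show ?thesis using assms by simp
qed

text \<open>Varying \<open>a\<close> and \<open>b\<close> gives access to the off-diagonal entry,
  which is the polarisation used below; with the identity matrix the formula yields the norm of the
  same vector.\<close>

lemma two_level_form:
  fixes B :: "complex mat" and a b :: complex
  assumes B: "B \<in> carrier_mat n n" and ij: "i < n" "j < n" "i \<noteq> j"
  defines "x \<equiv> vec n (\<lambda>k. if k = i then a else if k = j then b else 0)"
  shows "(B *\<^sub>v x) \<bullet>c x = (B $$ (i, i) * a + B $$ (i, j) * b) * cnj a + (B $$ (j, i) * a + B $$ (j, j) * b) * cnj b"
proof -
  have x: "x \<in> carrier_vec n" by (simp add: x_def)
  have sum2: "(\<Sum>k<n. f k (x $ k)) = f i a + f j b" if "\<And>k. f k 0 = 0" for f :: "nat \<Rightarrow> complex \<Rightarrow> complex"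
  proof -
    have "(\<Sum>k<n. f k (x $ k)) = (\<Sum>k<n. (if k = i then f i a else 0) + (if k = j then f j b else 0))"
      using ij that by (intro sum.cong) (auto simp: x_def)
    then show ?thesis using ij by (simp add: sum.distrib)
  qed
  have Bx: "(B *\<^sub>v x) $ k = B $$ (k, i) * a + B $$ (k, j) * b" if "k < n" for k
    using index_mult_mat_vec_sum[OF B x that] sum2[of "\<lambda>l t. B $$ (k, l) * t"] by simp
  show ?thesis
    using cscalar_prod_sum[OF x, of "B *\<^sub>v x"] sum2[of "\<lambda>k t. (B *\<^sub>v x) $ k * cnj t"] ij
    by (simp add: Bx del: index_mult_mat_vec)
qed

context diagonalized
begin

lemma V_mult_vec_carrier: "x \<in> carrier_vec n \<Longrightarrow> V *\<^sub>v x \<in> carrier_vec n"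
  by (rule mult_mat_vec_carrier[OF V_carrier])

lemma V_adjoint_V_mult_vec: "x \<in> carrier_vec n \<Longrightarrow> mat_adjoint V *\<^sub>v (V *\<^sub>v x) = x"
  using assoc_mult_mat_vec[OF V_adjoint_carrier V_carrier] by (simp add: V_unit)

lemma rotate_basis_form:
  assumes B: "B \<in> carrier_mat n n" and x: "x \<in> carrier_vec n"
  shows "(B *\<^sub>v (V *\<^sub>v x)) \<bullet>c (V *\<^sub>v x) = (rotate_basis B *\<^sub>v x) \<bullet>c x"
proof -
  have BVx: "B *\<^sub>v (V *\<^sub>v x) \<in> carrier_vec n"
    by (rule mult_mat_vec_carrier[OF B V_mult_vec_carrier[OF x]])
  have "(mat_adjoint V *\<^sub>v (B *\<^sub>v (V *\<^sub>v x))) \<bullet>c x = (B *\<^sub>v (V *\<^sub>v x)) \<bullet>c (V *\<^sub>v x)"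
    using cscalar_prod_mat_adjoint[OF V_adjoint_carrier BVx x] by simp
  moreover have "rotate_basis B *\<^sub>v x = mat_adjoint V *\<^sub>v (B *\<^sub>v (V *\<^sub>v x))"
    using assoc_mult_mat_vec[OF mult_carrier_mat[OF V_adjoint_carrier B] V_carrier x]
      assoc_mult_mat_vec[OF V_adjoint_carrier B V_mult_vec_carrier[OF x]]
    by (simp add: rotate_basis_def)
  ultimately show ?thesis by simp
qed

lemma V_mult_vec_norm:
  assumes x: "x \<in> carrier_vec n"
  shows "(V *\<^sub>v x) \<bullet>c (V *\<^sub>v x) = x \<bullet>c x"
  using cscalar_prod_mat_adjoint[OF V_carrier x V_mult_vec_carrier[OF x]] by (simp add: V_adjoint_V_mult_vec[OF x])

lemma V_mult_vec_eigenvector: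
  assumes x: "x \<in> carrier_vec n" and supp: "\<And>k. k < n \<Longrightarrow> x $ k \<noteq> 0 \<Longrightarrow> q k = l"
  shows "A *\<^sub>v (V *\<^sub>v x) = complex_of_real l \<cdot>\<^sub>v (V *\<^sub>v x)"
  using supp unfolding eigenvector_iff[OF V_mult_vec_carrier[OF x]] V_adjoint_V_mult_vec[OF x] by metis

lemma rotate_basis_adjoint:
  assumes "B \<in> carrier_mat n n"
  shows "mat_adjoint (rotate_basis B) = rotate_basis (mat_adjoint B)"
  using assms by (simp add: rotate_basis_def mat_adjoint_mult[of _ n n _ n] assoc)

text \<open>Positivity of the form on an eigenvector gives \<open>q i \<ge> 0\<close>, and full rank
  excludes 0 through the determinant. The ratios in the cooling criterion divide by these
  numbers.\<close>

lemma level_pos: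
  assumes psd: "psd_mat A" and rank: "full_rank A" and i: "i < n"
  shows "q i > 0"
proof -
  have "(A *\<^sub>v (V *\<^sub>v unit_vec n i)) \<bullet>c (V *\<^sub>v unit_vec n i) = complex_of_real (q i)"
    using rotate_basis_form[OF A_carrier unit_vec_carrier] mult_unit_vec_form[OF mat_diag_dim i] i
    by (simp add: rotate_basis_A) (simp add: mat_diag_def)
  moreover have "V *\<^sub>v unit_vec n i \<in> carrier_vec (dim_row A)"
    using V_mult_vec_carrier[OF unit_vec_carrier] by simp
  ultimately have "q i \<ge> 0" using psd unfolding psd_mat_def by fastforce
  moreover have "q i \<noteq> 0"
  proof
    assume "q i = 0"
    then have "det D = 0" unfolding det_mat_diag using i by (auto intro!: prod_zero)
    then have "det A = 0" unfolding A_eq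
      by (simp add: det_mult[of _ n] mult_carrier_mat[of _ n n])
    then show False using vec_space.det_rank_iff[OF A_carrier] rank by (simp add: full_rank_def)
  qed
  ultimately show ?thesis by simp
qed

text \<open>Constancy of the ratio over an eigenbasis and normalisation of the traces force the diagonal
  of the state to agree with that of \<open>A\<close>; polarisation inside each eigenspace removes the
  off-diagonal entries.\<close>

theorem usable_if_time_average_neq:
  fixes s :: "nat \<Rightarrow> real"
  assumes psd: "psd_mat A" and rank: "full_rank A" and trA: "trace_mat A = 1"
    and B: "B \<in> carrier_mat n n" "mat_adjoint B = B" and trB: "trace_mat B = 1"
    and s: "s 0 > 0" "s 1 > 0"
    and neq: "time_average A B \<noteq> A"
  defines "Q \<equiv> mat_diag 2 (\<lambda>i. complex_of_real (s i))"
  shows "usable_for_cooling (B, A) (Q, Q)"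
proof (rule ccontr)
  assume unusable: "\<not> usable_for_cooling (B, A) (Q, Q)"
  let ?R = "rotate_basis B"
  have R: "?R \<in> carrier_mat n n" using B by simp
  have herm: "?R $$ (i, j) = cnj (?R $$ (j, i))" if "i < n" "j < n" for i j
  proof -
    have "mat_adjoint ?R $$ (i, j) = cnj (?R $$ (j, i))"
      using that R carrier_matD[OF R] by simp
    then show ?thesis by (simp add: rotate_basis_adjoint[OF B(1)] B(2))
  qed
  have Aadj: "mat_adjoint A = A" using psd by (simp add: psd_mat_def hermitian_mat_def)
  \<comment> \<open>Here \<open>x\<close> is a coordinate vector in the eigenbasis: the eigenvector
    itself is \<open>V\<close> applied to \<open>x\<close>, with eigenvalue
    \<open>l\<close>.\<close>
  define unit_eigen where "unit_eigen x l \<longleftrightarrow> x \<in> carrier_vec n \<and> x \<bullet>c x = 1 \<and> l > 0 \<and>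
    (\<forall>k<n. x $ k \<noteq> 0 \<longrightarrow> q k = l)" for x :: "complex vec" and l
  have le: "Re ((?R *\<^sub>v x) \<bullet>c x) / l \<le> Re ((?R *\<^sub>v y) \<bullet>c y) / m"
    if x: "unit_eigen x l" and y: "unit_eigen y m" for x l y m
  proof (rule ccontr)
    assume "\<not> ?thesis"
    then have "usable_for_cooling (B, A) (Q, Q)"
      unfolding Q_def using x y s
      by (intro usable_if_eigenvector_ratios_differ[of A n B s "V *\<^sub>v x" l "V *\<^sub>v y" m])
        (auto simp: unit_eigen_def Aadj B(1) V_mult_vec_carrier V_mult_vec_norm
          V_mult_vec_eigenvector rotate_basis_form)
    then show False using unusable by contradiction
  qed
  \<comment> \<open>A strict inequality in either order would permit cooling, so swapping the two
    eigenvectors gives the reverse bound.\<close>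
  have ratio_eq: "Re ((?R *\<^sub>v x) \<bullet>c x) / l = Re ((?R *\<^sub>v y) \<bullet>c y) / m"
    if "unit_eigen x l" "unit_eigen y m" for x l y m
    using le[OF that] le[OF that(2,1)] by simp
  have qpos: "q i > 0" if "i < n" for i using level_pos[OF psd rank that] .
  have basis: "unit_eigen (unit_vec n i) (q i)" if "i < n" for i
    using that qpos mult_unit_vec_form[of "1\<^sub>m n" i]
    by (auto simp: unit_eigen_def split: if_splits)
  have n: "0 < n"
  proof (rule ccontr)
    assume "\<not> 0 < n"
    then have "trace_mat A = 0" by (simp add: trace_mat_def)
    then show False using trA by simp
  qed
  \<comment> \<open>The common ratio is read off at index 0, which exists because the trace 1
    excludes dimension 0.\<close>
  define c where "c = Re (?R $$ (0, 0)) / q 0"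
  have ratio: "Re ((?R *\<^sub>v x) \<bullet>c x) = c * l" if "unit_eigen x l" for x l
    using ratio_eq[OF that basis[OF n]] that mult_unit_vec_form[OF R n]
    by (simp add: c_def unit_eigen_def field_simps)
  have diag_c: "Re (?R $$ (i, i)) = c * q i" if "i < n" for i
    using ratio[OF basis[OF that]] mult_unit_vec_form[OF R that] by simp
  have "(\<Sum>i<n. Re (?R $$ (i, i))) = 1"
    using trace_rotate_basis[OF B(1)] trB carrier_matD(1)[OF R] by (simp add: trace_mat_def flip: Re_sum)
  moreover have "(\<Sum>i<n. q i) = 1"
  proof -
    have "trace_mat D = 1" using trace_rotate_basis[OF A_carrier] trA by (simp add: rotate_basis_A)
    then have "complex_of_real (\<Sum>i<n. q i) = 1" by (simp add: trace_mat_def mat_diag_def)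
    then show ?thesis using of_real_eq_1_iff by blast
  qed
  ultimately have "c = 1" by (simp add: diag_c sum_distrib_left[symmetric])
  have diag: "?R $$ (i, i) = complex_of_real (q i)" if "i < n" for i
    using diag_c[OF that] herm[OF that that] \<open>c = 1\<close> by (simp add: complex_eq_iff)
  have offdiag: "?R $$ (i, j) = 0" if ij: "i < n" "j < n" "i \<noteq> j" "q i = q j" for i j
  proof -
    \<comment> \<open>The test vector is (e_i + \<zeta> e_j) / sqrt 2, an eigenvector because
      \<open>q i = q j\<close>. Its form is \<open>q i\<close> plus this real part and also equals
      \<open>q i\<close> by \<open>ratio\<close>. The phases 1 and \<open>\<i>\<close> then give the
      real and the imaginary part of the entry.\<close>
    have "Re (\<zeta> * ?R $$ (i, j)) = 0" if \<zeta>: "\<zeta> * cnj \<zeta> = 1" for \<zeta>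
    proof -
      define r where "r = complex_of_real (1 / sqrt 2)"
      have r: "r * r = 1 / 2" "cnj r = r" by (simp_all add: r_def flip: of_real_mult)
      define x where "x = vec n (\<lambda>k. if k = i then r else if k = j then r * \<zeta> else 0)"
      have xc: "x \<in> carrier_vec n" by (simp add: x_def)
      have xx: "x \<bullet>c x = 1"
      proof -
        have "x \<bullet>c x = r * cnj r + (r * \<zeta>) * cnj (r * \<zeta>)"
          using two_level_form[OF one_carrier_mat ij(1-3), of r "r * \<zeta>"] xc ij by (simp add: x_def[symmetric])
        also have "\<dots> = (r * r) * (1 + \<zeta> * cnj \<zeta>)" by (simp add: r(2) algebra_simps)
        finally have "x \<bullet>c x = (r * r) * (1 + \<zeta> * cnj \<zeta>)" .
        then show ?thesis by (simp add: r \<zeta>)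
      qed
      have "unit_eigen x (q i)"
        using xc xx ij qpos by (auto simp: unit_eigen_def x_def)
      then have val: "Re ((?R *\<^sub>v x) \<bullet>c x) = q i" using ratio \<open>c = 1\<close> by simp
      have "(?R *\<^sub>v x) \<bullet>c x = (r * r) * (?R $$ (i, i) + ?R $$ (j, j) * (\<zeta> * cnj \<zeta>) +
          (\<zeta> * ?R $$ (i, j) + cnj (\<zeta> * ?R $$ (i, j))))"
        using two_level_form[OF R ij(1-3), of r "r * \<zeta>"] herm[OF ij(2,1)]
        by (simp add: x_def[symmetric] r(2) algebra_simps)
      also have "\<dots> = complex_of_real (q i) + complex_of_real (Re (\<zeta> * ?R $$ (i, j)))"
        unfolding complex_add_cnj \<zeta> r diag[OF ij(1)] diag[OF ij(2)] using ij(4) by simp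
      finally show ?thesis using val by simp
    qed
    from this[of 1] this[of \<i>] show ?thesis by (simp add: complex_eq_iff)
  qed
  have "time_average A B = A" unfolding time_average_eq_iff[OF B(1)] using diag offdiag by auto
  then show False using neq by contradiction
qed

end

lemma qubit_gibbs_mat_diag:
  "qubit_gibbs \<beta> E = mat_diag 2 (\<lambda>i. complex_of_real ((if i = 0 then 1 else exp (- \<beta> * E)) / (1 + exp (- \<beta> * E))))"
  by (intro eq_matI) (auto simp: qubit_gibbs_def mat_diag_def)

theorem mainTheorem4:
  fixes \<beta> E :: real and \<rho> \<gamma> :: "complex mat"
  assumes "\<beta> \<noteq> 0" and "E > 0"
    and "is_object (\<rho>, \<gamma>)" and "full_rank \<rho>" and "full_rank \<gamma>"
  shows "usable_for_cooling (\<rho>, \<gamma>) (qubit_gibbs \<beta> E, qubit_gibbs \<beta> E)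
     \<longleftrightarrow> time_average \<gamma> \<rho> \<noteq> \<gamma>"
proof -
  define n where "n = dim_row \<gamma>"
  have psd: "psd_mat \<gamma>" and tr: "trace_mat \<gamma> = 1" "trace_mat \<rho> = 1"
    and \<gamma>: "\<gamma> \<in> carrier_mat n n" "mat_adjoint \<gamma> = \<gamma>" and \<rho>: "\<rho> \<in> carrier_mat n n" "mat_adjoint \<rho> = \<rho>"
    using assms(3) by (auto simp: n_def is_object_def density_mat_def psd_mat_def hermitian_mat_def)
  obtain V q where "V \<in> carrier_mat n n" "unitary_mat V"
    "\<gamma> = V * mat_diag n (\<lambda>i. complex_of_real (q i)) * mat_adjoint V"
    using hermitian_unitarily_diagonalizable[OF \<gamma>] by blast
  then interpret diagonalized n \<gamma> V q by unfold_locales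
  have pos: "1 + exp (- \<beta> * E) > 0" by (simp add: add_pos_pos)
  show ?thesis
    unfolding qubit_gibbs_mat_diag
    using not_usable_if_time_average_eq[OF \<rho>(1)]
      usable_if_time_average_neq[OF psd assms(5) tr(1) \<rho> tr(2),
        of "\<lambda>i. (if i = 0 then 1 else exp (- \<beta> * E)) / (1 + exp (- \<beta> * E))"] pos
    by auto
qed

end
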